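(* The group $\mathcal{B}_n$ maps the set of planar words in $\Sigma_{0,1,n}$ to itself: if $w$ is planar and $\phi\in\mathcal{B}_n$, then $w^\phi$ is planar. In particular, if $n\ge1$, every element of $\{t_1^\phi:\phi\in\mathcal{B}_n\}$ is a planar word.
   Context: $\Sigma_{0,1,n}$ is the free group on $t_1,\dots,t_n$, $\overline t_k=t_k^{-1}$, and $z_1:=(t_1\cdots t_n)^{-1}$. Automorphisms act on the right as exponents. $\mathcal{B}_n$ is the group of automorphisms of $\Sigma_{0,1,n}$ fixing $z_1$ and permuting the conjugacy classes $\{[t_1],\dots,[t_n]\}$. Let $A$ be the set of formal symbols $\overline z_1,t_1,\overline t_1,\dots,t_n,\overline t_n,z_1$, totally ordered by $\overline z_1<t_1<\overline t_1<\dots<t_n<\overline t_n<z_1$. For a reduced word $a_1\cdots a_m$, its Whitehead expansion is $(c_1,\dots,c_{2m+2})=(\overline z_1,a_1,\overline a_1,\dots,a_m,\overline a_m,z_1)$. Two $2$-element sets of integers $\{a,b\},\{c,d\}$ are nested if $a,b,c,d$ are distinct and either both or neither of $c,d$ lie strictly between $a$ and $b$. A family of such sets is nested if every two distinct members are nested. A $2M$-tuple $(c_1,\dots,c_{2M})$ of elements of $A$ is planar if some permutation $\pi$ of $\{1,\dots,2M\}$ satisfies three conditions: - $\pi(i)<\pi(j)\Rightarrow c_i\le c_j$; - the family $\{\{\pi(2i-1),\pi(2i)\}\}_{1\le i\le M}$ is nested; - the family $\{\{\pi(2i),\pi(2i+1)\}\}_{1\le i\le M-1}$ is nested. An element $w$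 is a planar word if the Whitehead expansion of its reduced word is planar. *)

theory Defs
  imports "HOL-Combinatorics.Permutations"
begin

text \<open>A letter (i, True) stands for t_i, and (i, False) for its inverse.\<close>
type_synonym letter = "nat \<times> bool"
type_synonym word = "letter list"

definition inv_letter :: "letter \<Rightarrow> letter" where
  "inv_letter x = (fst x, \<not> snd x)"

fun reduced :: "word \<Rightarrow> bool" where
  "reduced [] = True"
| "reduced [x] = True"
| "reduced (x # y # ys) = (y \<noteq> inv_letter x \<and> reduced (y # ys))"

fun reduce :: "word \<Rightarrow> word" where
  "reduce [] = []"
| "reduce (x # xs) = (case reduce xs of
      [] \<Rightarrow> [x]
    | y # ys \<Rightarrow> (if y = inv_letter x then ys else x # y # ys))"

definition FG :: "nat \<Rightarrow> word set" where
  "FG n = {w. reduced w \<and> set w \<subseteq> {1..n} \<times> UNIV}"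

definition fg_mult :: "word \<Rightarrow> word \<Rightarrow> word" where
  "fg_mult u v = reduce (u @ v)"

definition fg_inv :: "word \<Rightarrow> word" where
  "fg_inv w = rev (map inv_letter w)"

definition gen :: "nat \<Rightarrow> word" where
  "gen i = [(i, True)]"

definition z1 :: "nat \<Rightarrow> word" where
  "z1 n = fg_inv (map (\<lambda>i. (i, True)) [1..<Suc n])"

definition conjugate :: "nat \<Rightarrow> word \<Rightarrow> word \<Rightarrow> bool" where
  "conjugate n u v \<longleftrightarrow> (\<exists>g\<in>FG n. u = fg_mult (fg_inv g) (fg_mult v g))"

definition is_aut :: "nat \<Rightarrow> (word \<Rightarrow> word) \<Rightarrow> bool" where
  "is_aut n \<phi> \<longleftrightarrow> bij_betw \<phi> (FG n) (FG n) \<and>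
     (\<forall>u\<in>FG n. \<forall>v\<in>FG n. \<phi> (fg_mult u v) = fg_mult (\<phi> u) (\<phi> v))"

text \<open>The group B_n: automorphisms fixing z_1 and permuting the conjugacy classes
  of t_1, ..., t_n. Automorphisms act on the right: w^phi is written phi w.\<close>
definition Bn :: "nat \<Rightarrow> (word \<Rightarrow> word) set" where
  "Bn n = {\<phi>. is_aut n \<phi> \<and> \<phi> (z1 n) = z1 n \<and>
     (\<exists>\<sigma>. \<sigma> permutes {1..n} \<and> (\<forall>i\<in>{1..n}. conjugate n (\<phi> (gen i)) (gen (\<sigma> i))))}"

text \<open>The ordered alphabet A is encoded by natural numbers preserving the order:
  zbar_1 = 0, t_i = 2i-1, tbar_i = 2i, z_1 = 2n+1.\<close>
definition code :: "letter \<Rightarrow> nat" where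
  "code x = (if snd x then 2 * fst x - 1 else 2 * fst x)"

definition whitehead :: "nat \<Rightarrow> word \<Rightarrow> nat list" where
  "whitehead n w = [0] @ concat (map (\<lambda>a. [code a, code (inv_letter a)]) w) @ [2 * n + 1]"

definition strictly_between :: "nat \<Rightarrow> nat \<Rightarrow> nat \<Rightarrow> bool" where
  "strictly_between a b x \<longleftrightarrow> min a b < x \<and> x < max a b"

definition nested_pair :: "nat set \<Rightarrow> nat set \<Rightarrow> bool" where
  "nested_pair S T \<longleftrightarrow> (\<exists>a b c d. S = {a, b} \<and> T = {c, d} \<and> distinct [a, b, c, d] \<and>
      (strictly_between a b c \<longleftrightarrow> strictly_between a b d))"

definition nested_family :: "nat set \<Rightarrow> (nat \<Rightarrow> nat set) \<Rightarrow> bool" where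
  "nested_family I F \<longleftrightarrow> (\<forall>i\<in>I. \<forall>j\<in>I. i \<noteq> j \<longrightarrow> nested_pair (F i) (F j))"

text \<open>A 2M-tuple (c_1,...,c_2M) is the list c with c_i = c ! (i - 1).\<close>
definition planar :: "nat list \<Rightarrow> bool" where
  "planar c \<longleftrightarrow> even (length c) \<and>
     (let M = length c div 2 in
      \<exists>\<pi>. \<pi> permutes {1..2 * M} \<and>
        (\<forall>i\<in>{1..2 * M}. \<forall>j\<in>{1..2 * M}. \<pi> i < \<pi> j \<longrightarrow> c ! (i - 1) \<le> c ! (j - 1)) \<and>
        nested_family {1..M} (\<lambda>i. {\<pi> (2 * i - 1), \<pi> (2 * i)}) \<and>
        nested_family {1..M - 1} (\<lambda>i. {\<pi> (2 * i), \<pi> (2 * i + 1)}))"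

definition planar_word :: "nat \<Rightarrow> word \<Rightarrow> bool" where
  "planar_word n w \<longleftrightarrow> w \<in> FG n \<and> planar (whitehead n w)"

end

theory Submission
  imports Defs
begin

text \<open>A planar word is the itinerary of an arc without self-crossings: the entries of the
  Whitehead expansion are places on a line, joined alternately by arcs in the upper and in the
  lower half plane. Such a picture can be drawn for a word that is not reduced, too, and an
  innermost pair of places bounding a cancellation can be deleted from it, so that free
  reduction preserves planarity. A half twist t_i -> t_{i+1}, t_{i+1} -> t_{i+1}^{-1} t_i t_{i+1}
  keeps all old places in their order and routes every arc around t_{i+1} through new places
  inserted immediately to the left of the block of t_i. Finally, Artin's length argument factors
  an element of the braid group into half twists and their inverses: in the product
  w_1^{-1} t_{k_1} w_1 ... w_n^{-1} t_{k_n} w_n = t_1 ... t_n either all w_i are trivial or some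
  w_i and w_{i+1} admit a shortening by a half twist.\<close>

section \<open>Free reduction\<close>

text \<open>A half twist of a reduced word is in general not reduced. The argument therefore runs on
  \<open>drawable\<close>, which does not ask for reducedness: the induction over the tuple of
  conjugates quantifies over the word, twists it unreduced, and reduces only once, when all
  exponents have become trivial. Places are distinct integers rather than values of a permutation,
  so that new ones can be inserted without renumbering. An arbitrary cancelling pair cannot be
  deleted from a picture: the arc that closes the hole may cross arcs ending between the two outer
  places of the pair. This is why an innermost pair is sought. The gap made for a half twist has
  width 4N because every rerouted arc receives four new places, one in each quarter of the gap.
  Along the path, translations and reflections of y alternate, so that the arcs joining consecutive
  places form concentric families.\<close>

lemma inv_letter_inv_letter [simp]: "inv_letter (inv_letter x) = x"
  by (simp add: inv_letter_def)

lemma inv_letter_neq [simp]: "inv_letter x \<noteq> x" "x \<noteq> inv_letter x"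
  by (auto simp: inv_letter_def prod_eq_iff)

lemma inv_letter_eq_iff [simp]: "inv_letter x = inv_letter y \<longleftrightarrow> x = y"
  by (metis inv_letter_inv_letter)

lemma reduced_Cons: "reduced (x # w) \<longleftrightarrow> reduced w \<and> (w = [] \<or> hd w \<noteq> inv_letter x)"
  by (cases w) auto

lemma reduced_append:
  "reduced (u @ v) \<longleftrightarrow>
     reduced u \<and> reduced v \<and> (u = [] \<or> v = [] \<or> hd v \<noteq> inv_letter (last u))"
  by (induction u) (auto simp: reduced_Cons hd_append)

lemma reduced_reduce: "reduced (reduce w)"
  by (induction w) (auto split: list.split simp: reduced_Cons)

lemma reduce_reduced: "reduced w \<Longrightarrow> reduce w = w"
  by (induction w rule: reduced.induct) auto

lemma reduce_reduce [simp]: "reduce (reduce w) = reduce w"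
  by (simp add: reduce_reduced reduced_reduce)

lemma length_reduce: "length (reduce w) \<le> length w"
  by (induction w) (auto split: list.split)

text \<open>If \<open>inv_letter x\<close> cancels a first letter \<open>x\<close> of
  \<open>reduce w\<close>, the new \<open>x\<close> puts it back. It cannot cancel further, because
  what follows \<open>x\<close> in a reduced word does not begin with
  \<open>inv_letter x\<close>.\<close>

lemma reduce_Cons_Cons_inv [simp]: "reduce (x # inv_letter x # w) = reduce w"
proof (cases "reduce w")
  case (Cons y ys)
  moreover have "reduced (y # ys)" using reduced_reduce[of w] Cons by simp
  ultimately show ?thesis
    by (auto split: list.split simp: reduced_Cons)
qed simp

lemma length_reduce_less: "\<not> reduced w \<Longrightarrow> length (reduce w) < length w"
proof (induction w)
  case (Cons x w)
  show ?case
  proof (cases "reduced w")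
    case True
    with Cons.prems obtain ys where "w = inv_letter x # ys"
      by (cases w) (auto simp: reduced_Cons)
    then show ?thesis
      using length_reduce[of ys] by (simp only: reduce_Cons_Cons_inv) simp
  next
    case False
    with Cons.IH show ?thesis by (auto split: list.split)
  qed
qed simp

lemma reduce_append_reduce_right [simp]: "reduce (u @ reduce v) = reduce (u @ v)"
  by (induction u) simp_all

text \<open>\<open>reduce\<close> works from the right end, so reducing a right factor is immediate,
  whereas a cancellation inside \<open>reduce (x # u)\<close> has to be replayed in front of
  \<open>v\<close>.\<close>

lemma reduce_append_reduce_left [simp]: "reduce (reduce u @ v) = reduce (u @ v)"
proof (induction u)
  case (Cons x u)
  show ?case
  proof (cases "reduce u")
    case Nil
    then have "reduce v = reduce (u @ v)" using Cons.IH by simp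
    then show ?thesis using Nil by simp
  next
    case c: (Cons y ys)
    have IH: "reduce (y # ys @ v) = reduce (u @ v)" using Cons.IH c by simp
    show ?thesis
    proof (cases "y = inv_letter x")
      case True
      \<comment> \<open>The letters \<open>x\<close> and \<open>inv_letter x\<close> are inserted in
        front of \<open>ys @ v\<close>, so that the induction hypothesis about
        \<open>inv_letter x # ys @ v\<close> applies.\<close>
      have "reduce (ys @ v) = reduce (x # reduce (inv_letter x # ys @ v))"
        using reduce_append_reduce_right[of "[x]" "inv_letter x # ys @ v"]
        by (metis append_Cons append_Nil reduce_Cons_Cons_inv)
      also have "\<dots> = reduce (x # reduce (u @ v))" using IH True by simp
      also have "\<dots> = reduce (x # u @ v)" 
        using reduce_append_reduce_right[of "[x]"] by simp
      finally show ?thesis using c True by simp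
    next
      case False
      then show ?thesis using c IH by simp
    qed
  qed
qed simp

abbreviation freely_equal :: "word \<Rightarrow> word \<Rightarrow> bool" (infix "\<simeq>" 50) where
  "u \<simeq> v \<equiv> reduce u = reduce v"

lemma freely_equal_append: "u \<simeq> u' \<Longrightarrow> v \<simeq> v' \<Longrightarrow> u @ v \<simeq> u' @ v'"
  by (metis reduce_append_reduce_left reduce_append_reduce_right)

lemma freely_equal_concat_map:
  "(\<And>x. x \<in> set xs \<Longrightarrow> f x \<simeq> g x) \<Longrightarrow> concat (map f xs) \<simeq> concat (map g xs)"
proof (induction xs)
  case (Cons x xs)
  have "f x @ concat (map f xs) \<simeq> g x @ concat (map g xs)"
    by (intro freely_equal_append Cons.IH Cons.prems) simp_all
  then show ?case by (simp only: list.map concat.simps)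
qed simp

lemma fg_inv_Nil [simp]: "fg_inv [] = []"
  and fg_inv_Cons [simp]: "fg_inv (x # u) = fg_inv u @ [inv_letter x]"
  and fg_inv_append [simp]: "fg_inv (u @ v) = fg_inv v @ fg_inv u"
  and fg_inv_fg_inv [simp]: "fg_inv (fg_inv u) = u"
  and length_fg_inv [simp]: "length (fg_inv u) = length u"
  and fg_inv_eq_Nil_iff [simp]: "fg_inv u = [] \<longleftrightarrow> u = []"
  by (simp_all add: fg_inv_def rev_map comp_def)

lemma set_fg_inv: "set (fg_inv u) = inv_letter ` set u"
  by (simp add: fg_inv_def)

lemma reduced_fg_inv: "reduced u \<Longrightarrow> reduced (fg_inv u)"
proof (induction u)
  case (Cons x u)
  then show ?case
    by (cases u) (auto simp: reduced_append)
qed simp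

lemma cancel_fg_inv_right: "u @ fg_inv u @ v \<simeq> v"
proof (induction u arbitrary: v)
  case (Cons x u)
  have "(x # u) @ fg_inv (x # u) @ v \<simeq> [x] @ (u @ fg_inv u @ (inv_letter x # v))" by simp
  also have "\<dots> = reduce ([x] @ inv_letter x # v)"
    by (rule freely_equal_append[OF refl Cons.IH])
  finally show ?case by (metis append_Cons append_Nil reduce_Cons_Cons_inv)
qed simp

lemma cancel_fg_inv_left: "fg_inv u @ u @ v \<simeq> v"
  using cancel_fg_inv_right[of "fg_inv u"] by simp

text \<open>Uniqueness of inverses: up to free reduction, u^-1 = u^-1 v v^-1 = u^-1 u v^-1 =
  v^-1.\<close>

lemma freely_equal_fg_inv:
  assumes "u \<simeq> v"
  shows "fg_inv u \<simeq> fg_inv v"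
proof -
  have "fg_inv u \<simeq> fg_inv u @ (v @ fg_inv v)"
    using freely_equal_append[OF refl cancel_fg_inv_right[of v "[]"], of "fg_inv u"] by simp
  also have "\<dots> = reduce (fg_inv u @ (u @ fg_inv v))"
    by (intro freely_equal_append assms[symmetric] refl)
  also have "\<dots> = reduce (fg_inv v)" by (rule cancel_fg_inv_left)
  finally show ?thesis .
qed

text \<open>Locates the cancellation in u v^-1: the common suffix \<open>c\<close> disappears and
  \<open>x @ fg_inv y\<close> is the reduced form.\<close>

lemma common_suffix_decomposition:
  assumes "reduced u" "reduced v"
  obtains x y c where "u = x @ c" "v = y @ c" "reduced (x @ fg_inv y)"
  using assms
proof (induction u arbitrary: v thesis rule: rev_induct)
  case Nil
  show ?case
    by (rule Nil(1)[of "[]" "[]" v]) (use Nil in \<open>auto simp: reduced_fg_inv\<close>)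
next
  case (snoc a u)
  show ?case
  proof (cases v rule: rev_cases)
    case Nil
    show ?thesis
      by (rule snoc.prems(1)[of "u @ [a]" "[]" "[]"]) (use snoc Nil in auto)
  next
    case v: (snoc v' b)
    show ?thesis
    proof (cases "a = b")
      case True
      obtain x y c where "u = x @ c" "v' = y @ c" "reduced (x @ fg_inv y)"
        using snoc.IH[of v'] snoc.prems v by (auto simp: reduced_append)
      then show ?thesis
        by (intro snoc.prems(1)[of x "c @ [b]" y]) (use v True in auto)
    next
      case False
      have "reduced ((u @ [a]) @ fg_inv v)"
        using snoc.prems(2) reduced_fg_inv[OF snoc.prems(3)] False v
        unfolding reduced_append[of "u @ [a]" "fg_inv v"] by auto
      then show ?thesis
        by (intro snoc.prems(1)[of "u @ [a]" "[]" v]) auto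
    qed
  qed
qed

section \<open>Noncrossing families of arcs\<close>

definition between :: "'a::linorder \<Rightarrow> 'a \<Rightarrow> 'a \<Rightarrow> bool" where
  "between a b x \<longleftrightarrow> a < x \<and> x < b \<or> b < x \<and> x < a"

text \<open>An arc is compatible with itself under this condition, so a plain set of pairs can serve
  as the family; distinctness of endpoints is recorded separately, in the list of all
  places.\<close>

definition noncrossing :: "('a::linorder \<times> 'a) set \<Rightarrow> bool" where
  "noncrossing S \<longleftrightarrow> (\<forall>(a, b)\<in>S. \<forall>(c, d)\<in>S. between a b c \<longleftrightarrow> between a b d)"

lemma noncrossingD:
  "noncrossing S \<Longrightarrow> (a, b) \<in> S \<Longrightarrow> (c, d) \<in> S \<Longrightarrow> between a b c \<longleftrightarrow> between a b d"
  unfolding noncrossing_def by blast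

lemma noncrossing_subset: "noncrossing T \<Longrightarrow> S \<subseteq> T \<Longrightarrow> noncrossing S"
  unfolding noncrossing_def by blast

lemma between_commute: "between a b x \<longleftrightarrow> between b a x"
  unfolding between_def by auto

text \<open>Arcs arise oriented by the word that runs along them; this allows each to be oriented at
  will, for instance from the block of a generator to that of its inverse.\<close>

lemma noncrossing_unoriented:
  assumes "noncrossing T" "S \<subseteq> T \<union> T\<inverse>"
  shows "noncrossing S"
proof -
  have "between a b c \<longleftrightarrow> between a b d" if "(a, b) \<in> S" "(c, d) \<in> S" for a b c d
  proof -
    have "(a, b) \<in> T \<or> (b, a) \<in> T" "(c, d) \<in> T \<or> (d, c) \<in> T" using that assms(2) by auto
    then show ?thesis
      using noncrossingD[OF assms(1), of a b c d] noncrossingD[OF assms(1), of b a c d]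
        noncrossingD[OF assms(1), of a b d c] noncrossingD[OF assms(1), of b a d c]
        between_commute[of a b c] between_commute[of a b d] by blast
  qed
  then show ?thesis unfolding noncrossing_def by blast
qed

text \<open>Both sides express that two chords without a common endpoint do not cross.\<close>

lemma between_symmetric:
  fixes a b c d :: int
  shows "\<lbrakk>a \<noteq> c; a \<noteq> d; b \<noteq> c; b \<noteq> d\<rbrakk> \<Longrightarrow>
     (between a b c \<longleftrightarrow> between a b d) \<longleftrightarrow> (between c d a \<longleftrightarrow> between c d b)"
  unfolding between_def by (smt (verit))

lemma noncrossing_image:
  assumes "strict_mono_on A f" "S \<subseteq> A \<times> A"
  shows "noncrossing (map_prod f f ` S) \<longleftrightarrow> noncrossing S"
proof -
  have *: "f x < f y \<longleftrightarrow> x < y" if "x \<in> A" "y \<in> A" for x y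
    using strict_mono_on_less[OF assms(1) that] .
  have "between (f a) (f b) (f c) \<longleftrightarrow> between a b c" if "a \<in> A" "b \<in> A" "c \<in> A" for a b c
    using that by (simp add: between_def *)
  then have "(between (f a) (f b) (f c) \<longleftrightarrow> between (f a) (f b) (f d)) \<longleftrightarrow>
      (between a b c \<longleftrightarrow> between a b d)" if "(a, b) \<in> S" "(c, d) \<in> S" for a b c d
    using that assms(2) by (simp add: subset_iff)
  moreover have "noncrossing (map_prod f f ` S) \<longleftrightarrow> (\<forall>(a, b)\<in>S. \<forall>(c, d)\<in>S.
      between (f a) (f b) (f c) \<longleftrightarrow> between (f a) (f b) (f d))"
    unfolding noncrossing_def by (simp add: case_prod_beta)
  ultimately show ?thesis
    unfolding noncrossing_def by fast
qed

section \<open>Planarity in terms of distinct integer places\<close>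

fun pairs :: "'a list \<Rightarrow> ('a \<times> 'a) list" where
  "pairs (x # y # xs) = (x, y) # pairs xs"
| "pairs _ = []"

lemma pairs_map: "pairs (map f xs) = map (map_prod f f) (pairs xs)"
  by (induction xs rule: pairs.induct) auto

lemma set_pairs_subset: "set (pairs xs) \<subseteq> set xs \<times> set xs"
  by (induction xs rule: pairs.induct) auto

lemma set_pairs_map_upt:
  "set (pairs (map f [a..<a + 2 * m])) = (\<lambda>i. (f (a + 2 * i), f (a + 2 * i + 1))) ` {..<m}"
proof (induction m arbitrary: a)
  case (Suc m)
  have "[a..<a + 2 * Suc m] = a # Suc a # [Suc (Suc a)..<Suc (Suc a) + 2 * m]"
    by (simp add: upt_conv_Cons)
  then show ?case
    using Suc[of "Suc (Suc a)"] by (simp add: lessThan_Suc_eq_insert_0 image_image)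
qed simp

lemma pairs_snoc_even: "even (length xs) \<Longrightarrow> pairs (xs @ [x]) = pairs xs"
  by (induction xs rule: pairs.induct) auto

lemma strictly_between_iff: "strictly_between a b x \<longleftrightarrow> between a b x"
  unfolding strictly_between_def between_def by auto

lemma nested_pair_doubleton:
  "nested_pair {a, b} {c, d} \<longleftrightarrow> distinct [a, b, c, d] \<and> (between a b c \<longleftrightarrow> between a b d)"
proof
  assume "nested_pair {a, b} {c, d}"
  then obtain p q r s where *: "{a, b} = {p, q}" "{c, d} = {r, s}" "distinct [p, q, r, s]"
      "between p q r \<longleftrightarrow> between p q s"
    unfolding nested_pair_def strictly_between_iff by blast
  from *(1,2) have "a = p \<and> b = q \<or> a = q \<and> b = p" "c = r \<and> d = s \<or> c = s \<and> d = r"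
    by (auto simp: doubleton_eq_iff)
  with *(3,4) show "distinct [a, b, c, d] \<and> (between a b c \<longleftrightarrow> between a b d)"
    using between_commute[of p q] by auto
next
  assume "distinct [a, b, c, d] \<and> (between a b c \<longleftrightarrow> between a b d)"
  then show "nested_pair {a, b} {c, d}"
    unfolding nested_pair_def strictly_between_iff by blast
qed

lemma nested_family_iff_noncrossing:
  assumes "\<And>i j. i \<in> I \<Longrightarrow> j \<in> I \<Longrightarrow> i \<noteq> j \<Longrightarrow> distinct [f i, g i, f j, g j]"
  shows "nested_family I (\<lambda>i. {f i, g i}) \<longleftrightarrow> noncrossing ((\<lambda>i. (f i, g i)) ` I)"
proof
  assume l: "nested_family I (\<lambda>i. {f i, g i})"
  have "between (f i) (g i) (f j) \<longleftrightarrow> between (f i) (g i) (g j)" if "i \<in> I" "j \<in> I" for i j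
  proof (cases "i = j")
    case True
    then show ?thesis by (auto simp: between_def)
  next
    case False
    then show ?thesis using l that unfolding nested_family_def nested_pair_doubleton by blast
  qed
  then show "noncrossing ((\<lambda>i. (f i, g i)) ` I)" unfolding noncrossing_def by blast
next
  assume "noncrossing ((\<lambda>i. (f i, g i)) ` I)"
  then show "nested_family I (\<lambda>i. {f i, g i})"
    using assms unfolding nested_family_def nested_pair_doubleton noncrossing_def by fast
qed

lemma planar_iff_permutation:
  assumes "length c = 2 * M"
  shows "planar c \<longleftrightarrow> (\<exists>\<pi>. \<pi> permutes {1..2 * M} \<and>
     (\<forall>i\<in>{1..2 * M}. \<forall>j\<in>{1..2 * M}. c ! (i - 1) < c ! (j - 1) \<longrightarrow> \<pi> i < \<pi> j) \<and>
     noncrossing (set (pairs (map \<pi> [1..<Suc (2 * M)]))) \<and>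
     noncrossing (set (pairs (tl (map \<pi> [1..<Suc (2 * M)])))))"
proof -
  have "(\<forall>i\<in>{1..2 * M}. \<forall>j\<in>{1..2 * M}. \<pi> i < \<pi> j \<longrightarrow> c ! (i - 1) \<le> c ! (j - 1)) \<longleftrightarrow>
        (\<forall>i\<in>{1..2 * M}. \<forall>j\<in>{1..2 * M}. c ! (i - 1) < c ! (j - 1) \<longrightarrow> \<pi> i < \<pi> j)"
    (is "?A \<longleftrightarrow> ?B")
    and "nested_family {1..M} (\<lambda>i. {\<pi> (2 * i - 1), \<pi> (2 * i)}) \<longleftrightarrow>
      noncrossing (set (pairs (map \<pi> [1..<Suc (2 * M)])))" (is "?C \<longleftrightarrow> ?D")
    and "nested_family {1..M - 1} (\<lambda>i. {\<pi> (2 * i), \<pi> (2 * i + 1)}) \<longleftrightarrow>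
      noncrossing (set (pairs (tl (map \<pi> [1..<Suc (2 * M)]))))" (is "?E \<longleftrightarrow> ?F")
    if \<pi>: "\<pi> permutes {1..2 * M}" for \<pi>
  proof -
    have inj: "\<pi> i = \<pi> j \<longleftrightarrow> i = j" for i j
      using permutes_inj[OF \<pi>] by (auto dest: injD)
    have "(\<pi> i < \<pi> j \<longrightarrow> c ! (i - 1) \<le> c ! (j - 1)) \<longleftrightarrow> (c ! (j - 1) < c ! (i - 1) \<longrightarrow> \<pi> j < \<pi> i)"
      for i j
      using inj[of i j] by (cases "i = j") (auto simp: not_less le_less)
    then show "?A \<longleftrightarrow> ?B" by blast
    have "(\<lambda>i. (\<pi> (2 * i - 1), \<pi> (2 * i))) ` {1..M} =
        (\<lambda>i. (\<pi> (1 + 2 * i), \<pi> (1 + 2 * i + 1))) ` {..<M}"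
      unfolding image_Suc_lessThan[symmetric] image_image by (intro image_cong) auto
    also have "\<dots> = set (pairs (map \<pi> [1..<Suc (2 * M)]))"
      using set_pairs_map_upt[of \<pi> 1 M] by simp
    finally have eq: "set (pairs (map \<pi> [1..<Suc (2 * M)])) =
      (\<lambda>i. (\<pi> (2 * i - 1), \<pi> (2 * i))) ` {1..M}" by simp
    have "2 * i - 1 \<noteq> 2 * i \<and> 2 * i - 1 \<noteq> 2 * j - 1 \<and> 2 * i - 1 \<noteq> 2 * j \<and> 2 * i \<noteq> 2 * j - 1"
      if "i \<in> {1..M}" "j \<in> {1..M}" "i \<noteq> j" for i j
      using that by simp presburger
    then show "?C \<longleftrightarrow> ?D"
      unfolding eq by (intro nested_family_iff_noncrossing) (simp add: inj)
    show "?E \<longleftrightarrow> ?F"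
    proof (cases M)
      case 0
      then show ?thesis by (simp add: nested_family_def noncrossing_def)
    next
      case (Suc m)
      \<comment> \<open>Without its first entry the list has odd length, and \<open>pairs\<close>
        ignores the last entry \<open>\<pi> (2 * M)\<close>.\<close>
      have "tl (map \<pi> [1..<Suc (2 * M)]) = map \<pi> [2..<2 + 2 * m] @ [\<pi> (2 * M)]"
        using Suc by (simp add: upt_rec[of 1] numeral_2_eq_2 map_tl[symmetric])
      then have "set (pairs (tl (map \<pi> [1..<Suc (2 * M)]))) =
          (\<lambda>i. (\<pi> (2 + 2 * i), \<pi> (2 + 2 * i + 1))) ` {..<m}"
        using set_pairs_map_upt[of \<pi> 2 m] by (simp add: pairs_snoc_even)
      also have "\<dots> = (\<lambda>i. (\<pi> (2 * i), \<pi> (2 * i + 1))) ` {1..M - 1}"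
        unfolding Suc diff_Suc_1 image_Suc_lessThan[symmetric] image_image
        by (intro image_cong) auto
      finally have eq: "set (pairs (tl (map \<pi> [1..<Suc (2 * M)]))) =
        (\<lambda>i. (\<pi> (2 * i), \<pi> (2 * i + 1))) ` {1..M - 1}" .
      show ?thesis
        unfolding eq by (intro nested_family_iff_noncrossing)
          (simp add: inj double_not_eq_Suc_double Suc_double_not_eq_double)
    qed
  qed
  note eqs = this
  have "length c div 2 = M" "even (length c)" using assms by simp_all
  then show ?thesis
    unfolding planar_def Let_def by (simp only: eqs simp_thms cong: conj_cong)
qed

text \<open>Only the relative order of the places matters: a permutation is a special list of keys,
  and conversely the ranks of the keys form a permutation.\<close>

lemma planar_iff_keys:
  assumes "length c = 2 * M"
  shows "planar c \<longleftrightarrow> (\<exists>ks :: int list. length ks = length c \<and> distinct ks \<and>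
     (\<forall>(x, k)\<in>set (zip c ks). \<forall>(y, l)\<in>set (zip c ks). x < y \<longrightarrow> k < l) \<and>
     noncrossing (set (pairs ks)) \<and> noncrossing (set (pairs (tl ks))))" (is "_ \<longleftrightarrow> ?R")
proof
  assume "planar c"
  then obtain \<pi> where \<pi>: "\<pi> permutes {1..2 * M}"
    and mono: "\<forall>i\<in>{1..2 * M}. \<forall>j\<in>{1..2 * M}. c ! (i - 1) < c ! (j - 1) \<longrightarrow> \<pi> i < \<pi> j"
    and nc: "noncrossing (set (pairs (map \<pi> [1..<Suc (2 * M)])))"
      "noncrossing (set (pairs (tl (map \<pi> [1..<Suc (2 * M)]))))"
    unfolding planar_iff_permutation[OF assms] by blast
  define K where "K = map \<pi> [1..<Suc (2 * M)]"
  have [simp]: "length K = 2 * M" by (simp add: K_def)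
  have nth: "K ! i = \<pi> (i + 1)" if "i < 2 * M" for i
    using that by (simp add: K_def del: upt_Suc)
  have "distinct K"
    unfolding K_def distinct_map using permutes_inj_on[OF \<pi>] by simp
  then have "distinct (map int K)" by (simp add: distinct_map)
  moreover have "noncrossing (set (pairs (map int K)))"
    unfolding pairs_map set_map
    by (subst noncrossing_image[where A = UNIV]) (use nc in \<open>auto simp: K_def strict_mono_on_def
        simp del: upt_Suc\<close>)
  moreover have "noncrossing (set (pairs (tl (map int K))))"
    unfolding pairs_map set_map map_tl[symmetric]
    by (subst noncrossing_image[where A = UNIV]) (use nc in \<open>auto simp: K_def strict_mono_on_def
        simp del: upt_Suc\<close>)
  moreover have "\<forall>(x, k)\<in>set (zip c (map int K)). \<forall>(y, l)\<in>set (zip c (map int K)). x < y \<longrightarrow> k < l"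
    using mono assms by (auto simp: in_set_zip nth)
  ultimately show ?R using assms by (intro exI[of _ "map int K"]) auto
next
  assume ?R
  then obtain ks :: "int list" where len: "length ks = length c" and dist: "distinct ks"
    and mono: "\<forall>(x, k)\<in>set (zip c ks). \<forall>(y, l)\<in>set (zip c ks). x < y \<longrightarrow> k < l"
    and nc: "noncrossing (set (pairs ks))" "noncrossing (set (pairs (tl ks)))"
    by blast
  \<comment> \<open>The rank counts \<open>x\<close> itself, so ranks start at 1 and fill
    \<open>{1..2 * M}\<close>.\<close>
  define r where "r x = card {y \<in> set ks. y \<le> x}" for x
  have smono: "strict_mono_on (set ks) r"
    unfolding strict_mono_on_def r_def
  proof (intro allI impI psubset_card_mono)
    fix x y assume "x \<in> set ks \<and> y \<in> set ks \<and> x < y"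
    then have "{z \<in> set ks. z \<le> x} \<subseteq> {z \<in> set ks. z \<le> y}"
      and "y \<in> {z \<in> set ks. z \<le> y} - {z \<in> set ks. z \<le> x}" by auto
    then show "{z \<in> set ks. z \<le> x} \<subset> {z \<in> set ks. z \<le> y}" by blast
  qed simp
  define \<pi> where "\<pi> i = (if i \<in> {1..2 * M} then r (ks ! (i - 1)) else i)" for i
  have map: "map \<pi> [1..<Suc (2 * M)] = map r ks"
    by (rule nth_equalityI) (use len assms in \<open>auto simp: \<pi>_def simp del: upt_Suc\<close>)
  have ls: "(ks ! (i - 1)) \<in> set ks" if "i \<in> {1..2 * M}" for i
    using that len assms by auto
  have "inj_on \<pi> {1..2 * M}"
  proof (rule inj_onI)
    fix i j assume ij: "i \<in> {1..2 * M}" "j \<in> {1..2 * M}" "\<pi> i = \<pi> j"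
    then have "ks ! (i - 1) = ks ! (j - 1)"
      using ls strict_mono_on_imp_inj_on[OF smono] by (auto simp: \<pi>_def dest: inj_onD)
    then show "i = j" using dist ij len assms by (auto simp: nth_eq_iff_index_eq)
  qed
  moreover have "\<pi> ` {1..2 * M} \<subseteq> {1..2 * M}"
  proof
    fix y assume "y \<in> \<pi> ` {1..2 * M}"
    then obtain i where i: "i \<in> {1..2 * M}" "y = \<pi> i" by blast
    define x where "x = ks ! (i - 1)"
    have x: "x \<in> set ks" "y = r x" using i ls[OF i(1)] by (simp_all add: x_def \<pi>_def)
    have "0 < r x" unfolding r_def using x by (auto simp: card_gt_0_iff)
    moreover have "r x \<le> card (set ks)" unfolding r_def by (intro card_mono) auto
    moreover have "card (set ks) = 2 * M" using dist len assms by (simp add: distinct_card)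
    ultimately show "y \<in> {1..2 * M}" using x by auto
  qed
  ultimately have "bij_betw \<pi> {1..2 * M} {1..2 * M}"
    by (simp add: bij_betw_def endo_inj_surj)
  then have "\<pi> permutes {1..2 * M}"
    by (rule bij_imp_permutes) (simp only: \<pi>_def if_False)
  moreover have "\<forall>i\<in>{1..2 * M}. \<forall>j\<in>{1..2 * M}. c ! (i - 1) < c ! (j - 1) \<longrightarrow> \<pi> i < \<pi> j"
  proof (intro ballI impI)
    fix i j assume ij: "i \<in> {1..2 * M}" "j \<in> {1..2 * M}" "c ! (i - 1) < c ! (j - 1)"
    have "(c ! (i - 1), ks ! (i - 1)) \<in> set (zip c ks)" "(c ! (j - 1),
        ks ! (j - 1)) \<in> set (zip c ks)"
      using ij len assms by (force simp: in_set_zip)+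
    then have "ks ! (i - 1) < ks ! (j - 1)" using mono ij by blast
    then show "\<pi> i < \<pi> j"
      using ij ls smono by (auto simp: \<pi>_def strict_mono_on_def)
  qed
  moreover have "noncrossing (set (pairs (map \<pi> [1..<Suc (2 * M)])))"
    unfolding map pairs_map set_map
    using noncrossing_image[OF smono set_pairs_subset] nc by blast
  moreover have "noncrossing (set (pairs (tl (map \<pi> [1..<Suc (2 * M)]))))"
  proof -
    have "set (pairs (tl ks)) \<subseteq> set ks \<times> set ks"
      using set_pairs_subset[of "tl ks"] by (cases ks) auto
    then show ?thesis
      unfolding map map_tl[symmetric] pairs_map set_map
      using noncrossing_image[OF smono] nc by blast
  qed
  ultimately show "planar c"
    unfolding planar_iff_permutation[OF assms] by blast
qed

section \<open>Drawings of words\<close>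

text \<open>A crossing (a, p, q) is a letter a of the word together with the places p and q on the
  real line of its two entries code a, code (inv_letter a) in the Whitehead expansion; s and e
  below are the places of the first and the last entry.\<close>

type_synonym crossing = "letter \<times> int \<times> int"

fun upper :: "int \<Rightarrow> crossing list \<Rightarrow> int \<Rightarrow> (int \<times> int) list" where
  "upper s [] e = [(s, e)]"
| "upper s ((a, p, q) # ws) e = (s, p) # upper q ws e"

definition labelled :: "nat \<Rightarrow> int \<Rightarrow> crossing list \<Rightarrow> int \<Rightarrow> (nat \<times> int) list" where
  "labelled n s ws e =
     (0, s) # concat (map (\<lambda>(a, p, q). [(code a, p), (code (inv_letter a), q)]) ws) @ [(2 * n + 1,
         e)]"

text \<open>The two families of arcs lie in opposite half planes and may cross each other freely:
  \<open>upper\<close> joins consecutive crossings and the two ends, while the place pair of each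
  crossing is its lower arc.\<close>

definition drawing :: "nat \<Rightarrow> int \<Rightarrow> crossing list \<Rightarrow> int \<Rightarrow> bool" where
  "drawing n s ws e \<longleftrightarrow>
     fst ` set ws \<subseteq> {1..n} \<times> UNIV \<and> distinct (map snd (labelled n s ws e)) \<and>
     (\<forall>(c, k)\<in>set (labelled n s ws e). \<forall>(d, l)\<in>set (labelled n s ws e). c < d \<longrightarrow> k < l) \<and>
     noncrossing (set (upper s ws e)) \<and> noncrossing (snd ` set ws)"

definition drawable :: "nat \<Rightarrow> word \<Rightarrow> bool" where
  "drawable n w \<longleftrightarrow> (\<exists>s ws e. drawing n s ws e \<and> map fst ws = w)"

lemma map_fst_labelled: "map fst (labelled n s ws e) = whitehead n (map fst ws)"
  by (simp add: labelled_def whitehead_def map_concat comp_def case_prod_beta)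

lemma pairs_labelled: "pairs (map snd (labelled n s ws e)) = upper s ws e"
  by (induction ws arbitrary: s) (auto simp: labelled_def)

lemma pairs_tl_labelled: "pairs (tl (map snd (labelled n s ws e))) = map snd ws"
  by (induction ws) (auto simp: labelled_def)

lemma length_whitehead: "length (whitehead n w) = 2 * (length w + 1)"
  by (induction w) (auto simp: whitehead_def)

lemma labelled_exists:
  assumes "length ks = 2 * (length w + 1)"
  obtains s ws e where "map fst ws = w" "map snd (labelled n s ws e) = ks"
proof -
  have *: "\<exists>ws e. map fst ws = w \<and> ks = concat (map (\<lambda>x. [fst (snd x), snd (snd x)]) ws) @ [e]"
    if "length ks = 2 * length w + 1" for w :: word and ks :: "int list"
    using that
  proof (induction w arbitrary: ks)
    case Nil
    then obtain e where "ks = [e]" by (auto simp: length_Suc_conv)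
    then show ?case by simp
  next
    case (Cons a w)
    then obtain p q ks' where ks: "ks = p # q # ks'" "length ks' = 2 * length w + 1"
      by (auto simp: length_Suc_conv)
    then obtain ws e where "map fst ws = w" "ks' = concat (map (\<lambda>x. [fst (snd x),
        snd (snd x)]) ws) @ [e]"
      using Cons.IH by blast
    then show ?case
      using ks by (intro exI[of _ "(a, p, q) # ws"] exI[of _ e]) simp
  qed
  obtain s ks' where ks: "ks = s # ks'" "length ks' = 2 * length w + 1"
    using assms by (auto simp: length_Suc_conv)
  with * obtain ws e where "map fst ws = w" "ks' = concat (map (\<lambda>x. [fst (snd x),
      snd (snd x)]) ws) @ [e]"
    by blast
  with ks show ?thesis
    by (intro that[of ws s e]) (auto simp: labelled_def map_concat comp_def case_prod_beta)
qed

text \<open>Keys and crossings carry the same data: zipping the Whitehead expansion with the keys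
  gives \<open>labelled\<close>, and the two pairings of the keys are the upper and the lower
  arcs.\<close>

lemma planar_word_iff_drawable: "planar_word n w \<longleftrightarrow> reduced w \<and> drawable n w"
proof
  assume w: "planar_word n w"
  then obtain ks :: "int list" where ks: "length ks = length (whitehead n w)" "distinct ks"
     "\<forall>(x, k)\<in>set (zip (whitehead n w) ks). \<forall>(y, l)\<in>set (zip (whitehead n w) ks). x < y \<longrightarrow> k < l"
     "noncrossing (set (pairs ks))" "noncrossing (set (pairs (tl ks)))"
    unfolding planar_word_def planar_iff_keys[OF length_whitehead] by blast
  obtain s ws e where ws: "map fst ws = w" "map snd (labelled n s ws e) = ks"
    by (rule labelled_exists[OF ks(1)[unfolded length_whitehead]])
  have "zip (whitehead n w) ks = labelled n s ws e"
    using zip_map_fst_snd[of "labelled n s ws e"] unfolding map_fst_labelled ws .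
  moreover have "fst ` set ws \<subseteq> {1..n} \<times> UNIV"
    using w ws unfolding planar_word_def FG_def by (metis (lifting) mem_Collect_eq set_map)
  moreover have "noncrossing (set (upper s ws e))" "noncrossing (snd ` set ws)"
    using ks(4,5) unfolding ws(2)[symmetric] pairs_labelled pairs_tl_labelled set_map by auto
  ultimately have "drawing n s ws e"
    unfolding drawing_def using ks ws by auto
  then show "reduced w \<and> drawable n w"
    using w ws unfolding drawable_def planar_word_def FG_def by blast
next
  assume "reduced w \<and> drawable n w"
  then obtain s ws e where red: "reduced w" and d: "drawing n s ws e" and w: "map fst ws = w"
    unfolding drawable_def by blast
  let ?ks = "map snd (labelled n s ws e)"
  have z: "zip (whitehead n w) ?ks = labelled n s ws e"
    using zip_map_fst_snd[of "labelled n s ws e"] unfolding map_fst_labelled w .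
  have "length ?ks = length (whitehead n w)"
    using arg_cong[OF map_fst_labelled[of n s ws e], of length] w by simp
  moreover have "noncrossing (set (pairs ?ks))" "noncrossing (set (pairs (tl ?ks)))"
    using d unfolding drawing_def pairs_labelled pairs_tl_labelled by auto
  ultimately have "planar (whitehead n w)"
    unfolding planar_iff_keys[OF length_whitehead]
    by (intro exI[of _ ?ks]) (use d in \<open>unfold z drawing_def, blast\<close>)
  moreover have "set w \<subseteq> {1..n} \<times> UNIV"
    using d w unfolding drawing_def by (metis set_map)
  ultimately show "planar_word n w"
    using red unfolding planar_word_def FG_def by blast
qed

section \<open>Cancellation in a drawing\<close>

lemma upper_append:
  "upper s (A @ (a, p, q) # B) e = upper s A p @ upper q B e"
  by (induction s A e rule: upper.induct) auto

text \<open>Only the last arc depends on the place \<open>x\<close> where a deleted part begins;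
  this names its other end. \<open>upper_eq_Cons\<close> does the same behind the deleted
  part.\<close>

lemma upper_eq_snoc: "\<exists>U \<alpha>. \<forall>x. upper s A x = U @ [(\<alpha>, x)]"
proof (cases A rule: rev_cases)
  case (snoc A' y)
  then show ?thesis by (cases y) (auto simp: upper_append)
qed auto

lemma upper_eq_Cons: "\<exists>\<beta> V. \<forall>x. upper x B e = (x, \<beta>) # V"
  by (cases B) auto

lemma concat_upper:
  "concat (map (\<lambda>(x, y). [x, y]) (upper s ws e)) = map snd (labelled n s ws e)"
  by (induction ws arbitrary: s) (auto simp: labelled_def)

lemma set_labelled: "set (labelled n s ws e) = insert (0, s) (insert (2 * n + 1, e)
    ((\<lambda>x. (code (fst x), fst (snd x))) ` set ws \<union>
     (\<lambda>x. (code (inv_letter (fst x)), snd (snd x))) ` set ws))"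
proof -
  have "(\<Union>x\<in>S. {g x, h x}) = g ` S \<union> h ` S" for g h :: "crossing \<Rightarrow> nat \<times> int" and S
    by auto
  then show ?thesis unfolding labelled_def by (simp add: case_prod_beta insert_commute)
qed

lemma drawing_label_less:
  "\<lbrakk>drawing n s ws e; (c, k) \<in> set (labelled n s ws e); (d, l) \<in> set (labelled n s ws e); c < d\<rbrakk>
    \<Longrightarrow> k < l"
  unfolding drawing_def by blast

text \<open>Since places are ordered by label, equal labels occupy a block that no other label
  interrupts.\<close>

lemma drawing_label_between:
  assumes "drawing n s ws e" "(c, x) \<in> set (labelled n s ws e)" "(c, z) \<in> set (labelled n s ws e)"
    "(d, y) \<in> set (labelled n s ws e)" "between x z y"
  shows "d = c"
  using drawing_label_less[OF assms(1,2,4)] drawing_label_less[OF assms(1,4,2)]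
    drawing_label_less[OF assms(1,3,4)] drawing_label_less[OF assms(1,4,3)] assms(5)
  unfolding between_def by (cases c d rule: linorder_cases) auto

text \<open>Index 0 has to be excluded: by truncated subtraction \<open>(0, True)\<close> and
  \<open>(0, False)\<close> both have code 0.\<close>

lemma code_inject: "code a = code b \<Longrightarrow> fst a \<ge> 1 \<Longrightarrow> fst b \<ge> 1 \<Longrightarrow> a = b"
  by (cases a; cases b) (auto simp: code_def split: if_splits; presburger)

text \<open>The upper arcs \<open>(\<alpha>, p)\<close>, \<open>(q, r)\<close>,
  \<open>(t, \<beta>)\<close> give way to the single arc \<open>(\<alpha>, \<beta>)\<close>. As no
  place separates \<open>p\<close> from \<open>t\<close>, these two lie on the same side of every
  remaining upper arc, and hence so do \<open>\<alpha>\<close> and \<open>\<beta>\<close>.\<close>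

lemma drawing_cancel:
  assumes d: "drawing n s (A @ (a, p, q) # (b, r, t) # B) e"
    and adj: "\<And>x. x \<in> snd ` set (labelled n s (A @ (a, p, q) # (b, r, t) # B) e) \<Longrightarrow> \<not> between p t x"
  shows "drawing n s (A @ B) e"
proof -
  let ?ws = "A @ (a, p, q) # (b, r, t) # B"
  obtain U \<alpha> where U: "\<And>x. upper s A x = U @ [(\<alpha>, x)]" using upper_eq_snoc by blast
  obtain V \<beta> where V: "\<And>x. upper x B e = (x, \<beta>) # V" using upper_eq_Cons by blast
  have old: "upper s ?ws e = U @ [(\<alpha>, p), (q, r), (t, \<beta>)] @ V"
    by (simp add: upper_append U V)
  have new: "upper s (A @ B) e = U @ (\<alpha>, \<beta>) # V"
  proof (cases B)
    case Nil
    then show ?thesis using U V[of 0] by simp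
  next
    case (Cons y B')
    then show ?thesis using U V[of 0] by (cases y) (simp add: upper_append)
  qed
  have nc: "noncrossing (set (upper s ?ws e))" using d unfolding drawing_def by blast
  have dist: "distinct (concat (map (\<lambda>(x, y). [x, y]) (upper s ?ws e)))"
    using d unfolding drawing_def concat_upper[of s ?ws e n] by blast
  have key: "between x y \<alpha> \<longleftrightarrow> between x y \<beta>" "between \<alpha> \<beta> x \<longleftrightarrow> between \<alpha> \<beta> y"
    if xy: "(x, y) \<in> set U \<union> set V" for x y
  proof -
    have ne: "x \<noteq> p" "x \<noteq> t" "y \<noteq> p" "y \<noteq> t" "x \<noteq> \<alpha>" "x \<noteq> \<beta>" "y \<noteq> \<alpha>" "y \<noteq> \<beta>"
    proof -
      let ?F = "\<lambda>L :: (int \<times> int) list. concat (map (\<lambda>(x, y). [x, y]) L)"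
      have "x \<in> set (?F U) \<union> set (?F V)" "y \<in> set (?F U) \<union> set (?F V)" using xy by force+
      moreover have "distinct (?F U @ [\<alpha>, p, q, r, t, \<beta>] @ ?F V)" using dist unfolding old by simp
      ultimately show "x \<noteq> p" "x \<noteq> t" "y \<noteq> p" "y \<noteq> t" "x \<noteq> \<alpha>" "x \<noteq> \<beta>" "y \<noteq> \<alpha>" "y \<noteq> \<beta>"
        unfolding distinct_append by (auto simp del: set_concat)
    qed
    have xy': "(x, y) \<in> set (upper s ?ws e)" using xy unfolding old by auto
    then have "{x, y} \<subseteq> set (concat (map (\<lambda>(x, y). [x, y]) (upper s ?ws e)))" by force
    then have adj': "\<not> between p t x" "\<not> between p t y"
      unfolding concat_upper[of s ?ws e n] using adj by auto
    have "between x y \<alpha> \<longleftrightarrow> between x y p" "between x y t \<longleftrightarrow> between x y \<beta>"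
      using noncrossingD[OF nc xy'] unfolding old by auto
    moreover have "between x y p \<longleftrightarrow> between x y t"
      using adj' ne unfolding between_def by (smt (verit))
    ultimately show "between x y \<alpha> \<longleftrightarrow> between x y \<beta>" by blast
    then show "between \<alpha> \<beta> x \<longleftrightarrow> between \<alpha> \<beta> y"
      using between_symmetric[of x \<alpha> \<beta> y] ne by blast
  qed
  have "noncrossing (set (upper s (A @ B) e))"
    unfolding noncrossing_def
  proof (clarify, goal_cases)
    case (1 x y u v)
    have triv: "between \<alpha> \<beta> \<alpha> \<longleftrightarrow> between \<alpha> \<beta> \<beta>" by (simp add: between_def)
    have "(x, y) = (\<alpha>, \<beta>) \<or> (x, y) \<in> set U \<union> set V" "(u, v) = (\<alpha>, \<beta>) \<or> (u, v) \<in> set U \<union> set V"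
      using 1 unfolding new by auto
    moreover have "between x y u \<longleftrightarrow> between x y v"
      if "(x, y) \<in> set U \<union> set V" "(u, v) \<in> set U \<union> set V"
      using noncrossingD[OF nc, of x y u v] that unfolding old by auto
    ultimately show ?case using key triv by blast
  qed
  moreover have "noncrossing (snd ` set (A @ B))"
    by (rule noncrossing_subset[of "snd ` set ?ws"]) (use d in \<open>auto simp: drawing_def\<close>)
  moreover have sub: "set (labelled n s (A @ B) e) \<subseteq> set (labelled n s ?ws e)"
    unfolding set_labelled by auto
  moreover have "distinct (map snd (labelled n s (A @ B) e))"
    using d unfolding drawing_def labelled_def by auto
  moreover have "fst ` set (A @ B) \<subseteq> {1..n} \<times> UNIV"
    using d unfolding drawing_def by auto
  moreover have "\<forall>(c, k)\<in>set (labelled n s (A @ B) e). \<forall>(d, l)\<in>set (labelled n s (A @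
      B) e). c < d \<longrightarrow> k < l"
    using drawing_label_less[OF d] sub by blast
  ultimately show ?thesis unfolding drawing_def by blast
qed

lemma not_reduced_split:
  "\<not> reduced (map f xs) \<Longrightarrow> \<exists>A x y B. xs = A @ x # y # B \<and> f y = inv_letter (f x)"
proof (induction xs rule: induct_list012)
  case (3 x y zs)
  show ?case
  proof (cases "f y = inv_letter (f x)")
    case True
    then show ?thesis by (intro exI[of _ "[]"] exI) simp
  next
    case False
    then obtain A x' y' B where "y # zs = A @ x' # y' # B" "f y' = inv_letter (f x')"
      using 3 by auto
    then show ?thesis by (intro exI[of _ "x # A"] exI) simp
  qed
qed auto

lemma code_range: "fst a \<in> {1..n} \<Longrightarrow> 0 < code a \<and> code a < 2 * n + 1"
  by (auto simp: code_def)

lemma fst_inv_letter [simp]: "fst (inv_letter a) = fst a"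
  by (simp add: inv_letter_def)

lemma drawing_letter: "drawing n s ws e \<Longrightarrow> (a, p, q) \<in> set ws \<Longrightarrow> fst a \<in> {1..n}"
  unfolding drawing_def by force

lemma labelled_crossing:
  assumes "(a, p, q) \<in> set ws"
  shows "(code a, p) \<in> set (labelled n s ws e)" "(code (inv_letter a), q) \<in> set (labelled n s ws e)"
  using assms unfolding set_labelled by force+

lemma labelled_letter_cases:
  assumes d: "drawing n s ws e" and x: "(code b, x) \<in> set (labelled n s ws e)" "fst b \<in> {1..n}"
  shows "(\<exists>y. (b, x, y) \<in> set ws) \<or> (\<exists>y. (inv_letter b, y, x) \<in> set ws)"
proof -
  consider a y where "(a, x, y) \<in> set ws" "code a = code b"
    | a y where "(a, y, x) \<in> set ws" "code (inv_letter a) = code b"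
    using x(1) code_range[OF x(2)] unfolding set_labelled by auto
  then show ?thesis
  proof cases
    case 1
    then have "a = b" using code_inject drawing_letter[OF d 1(1)] x(2) by auto
    then show ?thesis using 1 by blast
  next
    case 2
    then have "inv_letter a = b" using code_inject drawing_letter[OF d 2(1)] x(2) by auto
    then have "a = inv_letter b" by auto
    then show ?thesis using 2 by blast
  qed
qed

lemma code_inv_letter_neq: "fst a \<ge> 1 \<Longrightarrow> code a \<noteq> code (inv_letter a)"
  using code_inject[of a "inv_letter a"] by auto

text \<open>Take a cancelling pair with \<open>q\<close> and \<open>r\<close> as close as possible.
  A place between them would lie in their block, and so would the other end of its upper arc; that
  arc would then belong to a cancelling pair with a smaller distance. The lower arcs at
  \<open>q\<close> and \<open>r\<close> carry the emptiness over to the interval between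
  \<open>p\<close> and \<open>t\<close>.\<close>

lemma drawing_innermost:
  assumes d: "drawing n s ws e" and nr: "\<not> reduced (map fst ws)"
  obtains A a p q r t B where "ws = A @ (a, p, q) # (inv_letter a, r, t) # B"
    "\<And>x. x \<in> snd ` set (labelled n s ws e) \<Longrightarrow> \<not> between p t x"
proof -
  define P where "P g \<longleftrightarrow> (\<exists>A a p q r t B. ws = A @ (a, p, q) # (inv_letter a, r, t) # B \<and> g =
      nat \<bar>q - r\<bar>)" for g
  let ?L = "set (labelled n s ws e)"
  obtain A x y B where "ws = A @ x # y # B" "fst y = inv_letter (fst x)"
    using not_reduced_split[OF nr] by blast
  then have "ws = A @ (fst x, fst (snd x), snd (snd x)) #
      (inv_letter (fst x), fst (snd y), snd (snd y)) # B"
    by (metis prod.collapse)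
  then have "\<exists>g. P g" unfolding P_def by blast
  then obtain g where g: "P g" "\<And>h. P h \<Longrightarrow> g \<le> h"
    by (metis LeastI_ex Least_le)
  then obtain A a p q r t B where ws: "ws = A @ (a, p, q) # (inv_letter a, r, t) # B"
    and g_eq: "g = nat \<bar>q - r\<bar>"
    unfolding P_def by blast
  have least: "\<bar>q - r\<bar> \<le> \<bar>y - x\<bar>" if "ws = A' @ (b, p', y) # (inv_letter b, x, q') # B'"
      for A' b p' x y q' B'
  proof -
    have "P (nat \<bar>y - x\<bar>)" unfolding P_def using that by blast
    then show ?thesis using g(2) g_eq by force
  qed
  have mem: "(a, p, q) \<in> set ws" "(inv_letter a, r, t) \<in> set ws" unfolding ws by auto
  note fst_a = drawing_letter[OF d mem(1)]
  have L: "(code a, p) \<in> ?L" "(code (inv_letter a), q) \<in> ?L" "(code (inv_letter a), r) \<in> ?L"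
      "(code a, t) \<in> ?L"
    using labelled_crossing[OF mem(1), of n s e] labelled_crossing[OF mem(2), of n s e] by simp_all
  have nc: "noncrossing (set (upper s ws e))" "noncrossing (snd ` set ws)"
    using d unfolding drawing_def by auto
  have qr: "(q, r) \<in> set (upper s ws e)" unfolding ws by (simp add: upper_append)
  \<comment> \<open>The labels 0 and 2n+1 belong to no letter, so an upper arc starting between
    \<open>q\<close> and \<open>r\<close> cannot lead to an end of the word.\<close>
  have ends: "\<not> between q r s" "\<not> between q r e"
    using drawing_label_between[OF d L(2,3), of 0 s] drawing_label_between[OF d L(2,3), of
        "2 * n + 1" e]
      code_range[of "inv_letter a" n] fst_a unfolding set_labelled by force+
  have no_upper: "\<not> between q r x" if xL: "x \<in> snd ` ?L" for x
  proof
    assume x: "between q r x"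
    obtain c where "(c, x) \<in> ?L" using xL by auto
    with drawing_label_between[OF d L(2,3) _ x] have "(code (inv_letter a), x) \<in> ?L" by blast
    then consider y where "(inv_letter a, x, y) \<in> set ws" | y where "(a, y, x) \<in> set ws"
      using labelled_letter_cases[OF d, of "inv_letter a" x] fst_a by auto
    then show False
    proof cases
      case (1 y)
      then obtain A' B' where split: "ws = A' @ (inv_letter a, x, y) # B'" by (meson split_list)
      show False
      proof (cases A' rule: rev_cases)
        case Nil
        then have "(s, x) \<in> set (upper s ws e)" unfolding split by simp
        then show False using noncrossingD[OF nc(1) qr] x ends by blast
      next
        case (snoc A'' z)
        obtain b p' q' where z: "z = (b, p', q')" by (cases z) auto
        have "(q', x) \<in> set (upper s ws e)" unfolding split snoc z by (simp add: upper_append)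
        then have q': "between q r q'" using noncrossingD[OF nc(1) qr] x by blast
        have b: "(b, p', q') \<in> set ws" unfolding split snoc z by simp
        have "code (inv_letter b) = code (inv_letter a)"
          using drawing_label_between[OF d L(2,3) labelled_crossing(2)[OF b] q'] .
        then have "inv_letter b = inv_letter a"
          by (rule code_inject) (use fst_a drawing_letter[OF d b] in auto)
        then have "\<bar>q - r\<bar> \<le> \<bar>q' - x\<bar>" using least[of A'' b p' q' x y B'] split snoc z by simp
        then show False using x q' unfolding between_def by auto
      qed
    next
      case (2 y)
      then obtain A' B' where split: "ws = A' @ (a, y, x) # B'" by (auto dest: split_list)
      show False
      proof (cases B')
        case Nil
        then have "(x, e) \<in> set (upper s ws e)" unfolding split by (simp add: upper_append)
        then show False using noncrossingD[OF nc(1) qr] x ends by blast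
      next
        case (Cons z B'')
        obtain b p' q' where z: "z = (b, p', q')" by (cases z) auto
        have "(x, p') \<in> set (upper s ws e)" unfolding split Cons z by (simp add: upper_append)
        then have p': "between q r p'" using noncrossingD[OF nc(1) qr] x by blast
        have b: "(b, p', q') \<in> set ws" unfolding split Cons z by simp
        have "code b = code (inv_letter a)"
          using drawing_label_between[OF d L(2,3) labelled_crossing(1)[OF b] p'] .
        then have "b = inv_letter a"
          by (rule code_inject) (use fst_a drawing_letter[OF d b] in auto)
        then have "\<bar>q - r\<bar> \<le> \<bar>x - p'\<bar>" using least[of A' a y x p' q' B''] split Cons z by simp
        then show False using x p' unfolding between_def by auto
      qed
    qed
  qed
  \<comment> \<open>A place \<open>x\<close> between \<open>p\<close> and \<open>t\<close> lies in
    the block of \<open>a\<close>, and its lower arc leads to some \<open>y\<close> in the block of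
    the inverse. Since it crosses neither \<open>(p, q)\<close> nor \<open>(r, t)\<close>, the place
    \<open>y\<close> would be between \<open>q\<close> and \<open>r\<close>, which is already
    excluded.\<close>
  have "\<not> between p t x" if xL: "x \<in> snd ` ?L" for x
  proof
    assume x: "between p t x"
    obtain c where "(c, x) \<in> ?L" using xL by auto
    with drawing_label_between[OF d L(1,4) _ x] have xl: "(code a, x) \<in> ?L" by blast
    consider y where "(a, x, y) \<in> set ws" | y where "(inv_letter a, y, x) \<in> set ws"
      using labelled_letter_cases[OF d xl fst_a] by auto
    then obtain y where y: "(x, y) \<in> snd ` set ws \<or> (y, x) \<in> snd ` set ws" "(code (inv_letter a),
        y) \<in> ?L"
    proof cases
      case (1 y)
      then show ?thesis using labelled_crossing(2)[OF 1] that[of y] by force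
    next
      case (2 y)
      then show ?thesis using labelled_crossing(1)[OF 2] that[of y] by force
    qed
    have pq: "(p, q) \<in> snd ` set ws" "(r, t) \<in> snd ` set ws" using mem by force+
    have "between p q x \<longleftrightarrow> between p q y" "between r t x \<longleftrightarrow> between r t y"
      using noncrossingD[OF nc(2) pq(1), of x y] noncrossingD[OF nc(2) pq(1), of y x]
        noncrossingD[OF nc(2) pq(2), of x y] noncrossingD[OF nc(2) pq(2), of y x] y(1) by auto
    moreover have "between x y p \<longleftrightarrow> between x y q" "between x y r \<longleftrightarrow> between x y t"
      using noncrossingD[OF nc(2) _ pq(1)] noncrossingD[OF nc(2) _ pq(2)] y(1)
        between_commute[of x y] by blast+
    moreover have "\<not> between q r y" using no_upper y(2) by force
    moreover have "(\<forall>u\<in>{p, t, x}. \<forall>v\<in>{q, r, y}. u < v) \<or> (\<forall>u\<in>{p, t, x}. \<forall>v\<in>{q, r, y}. v < u)"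
    proof (cases "code a < code (inv_letter a)")
      case True
      then show ?thesis
        using drawing_label_less[OF d _ _ True] L xl y(2) by auto
    next
      case False
      then have "code (inv_letter a) < code a" using code_inv_letter_neq[of a] fst_a by auto
      then show ?thesis
        using drawing_label_less[OF d] L xl y(2) by auto
    qed
    ultimately show False using x unfolding between_def by (smt (verit) insertCI)
  qed
  with ws show ?thesis by (rule that)
qed

lemma drawable_reduce: "drawable n w \<Longrightarrow> drawable n (reduce w)"
proof (induction "length w" arbitrary: w rule: less_induct)
  case less
  show ?case
  proof (cases "reduced w")
    case True
    then show ?thesis using less.prems by (simp add: reduce_reduced)
  next
    case False
    obtain s ws e where d: "drawing n s ws e" and w: "map fst ws = w"
      using less.prems unfolding drawable_def by blast
    obtain A a p q r t B where ws: "ws = A @ (a, p, q) # (inv_letter a, r, t) # B"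
      and adj: "\<And>x. x \<in> snd ` set (labelled n s ws e) \<Longrightarrow> \<not> between p t x"
      using drawing_innermost[OF d] False w by blast
    have "drawing n s (A @ B) e"
      using drawing_cancel d adj unfolding ws by blast
    then have "drawable n (map fst (A @ B))" unfolding drawable_def by blast
    moreover have "length (map fst (A @ B)) < length w" using ws w by auto
    ultimately have "drawable n (reduce (map fst (A @ B)))" using less.hyps by blast
    moreover have "w \<simeq> map fst (A @ B)"
    proof -
      have "map fst A @ ([a, inv_letter a] @ map fst B) \<simeq> map fst A @ map fst B"
        by (rule freely_equal_append[OF refl]) (simp del: reduce.simps)
      then show ?thesis using ws w by auto
    qed
    ultimately show ?thesis by simp
  qed
qed

section \<open>Half twists\<close>

text \<open>Applied letter by letter and without reduction, so that each letter of the result stems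
  from one crossing of the old drawing.\<close>

definition half_twist :: "nat \<Rightarrow> letter \<Rightarrow> word" where
  "half_twist i a =
     (if fst a = i then [(Suc i, snd a)]
      else if fst a = Suc i then [(Suc i, False), (i, snd a), (Suc i, True)]
      else [a])"

lemma labelled_map:
  "labelled n (f s) (map (map_prod id (map_prod f f)) ws) (f e) =
      map (map_prod id f) (labelled n s ws e)"
  by (induction ws) (auto simp: labelled_def)

lemma upper_map:
  "upper (f s) (map (map_prod id (map_prod f f)) ws) (f e) = map (map_prod f f) (upper s ws e)"
  by (induction ws arbitrary: s) auto

lemma set_upper_subset:
  "set (upper s ws e) \<subseteq> snd ` set (labelled n s ws e) \<times> snd ` set (labelled n s ws e)"
  using set_pairs_subset[of "map snd (labelled n s ws e)"] unfolding pairs_labelled by simp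

lemma set_lower_subset:
  "snd ` set ws \<subseteq> snd ` set (labelled n s ws e) \<times> snd ` set (labelled n s ws e)"
  unfolding set_labelled by force

lemma drawing_map:
  assumes d: "drawing n s ws e" and f: "strict_mono_on (snd ` set (labelled n s ws e)) f"
  shows "drawing n (f s) (map (map_prod id (map_prod f f)) ws) (f e)"
proof -
  let ?L = "labelled n s ws e" and ?ws = "map (map_prod id (map_prod f f)) ws"
  have "fst ` set ?ws \<subseteq> {1..n} \<times> UNIV"
    using d unfolding drawing_def by auto
  moreover have "distinct (map snd (labelled n (f s) ?ws (f e)))"
  proof -
    have "map snd (labelled n (f s) ?ws (f e)) = map f (map snd ?L)"
      unfolding labelled_map by simp
    moreover have "distinct (map f (map snd ?L))"
      unfolding distinct_map[of f] using d strict_mono_on_imp_inj_on[OF f]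
      unfolding drawing_def by simp
    ultimately show ?thesis by metis
  qed
  moreover have "\<forall>(c, k)\<in>set (labelled n (f s) ?ws (f e)).
      \<forall>(c', l)\<in>set (labelled n (f s) ?ws (f e)). c < c' \<longrightarrow> k < l"
  proof -
    have "f k < f l" if "(c, k) \<in> set ?L" "(c', l) \<in> set ?L" "c < c'" for c k c' l
      by (rule strict_mono_onD[OF f]) (use that drawing_label_less[OF d] in force)+
    then show ?thesis unfolding labelled_map by auto
  qed
  moreover have "noncrossing (set (upper (f s) ?ws (f e)))"
    unfolding upper_map set_map noncrossing_image[OF f set_upper_subset]
    using d unfolding drawing_def by blast
  moreover have "noncrossing (snd ` set ?ws)"
  proof -
    have "snd ` set ?ws = map_prod f f ` (snd ` set ws)" by force
    then show ?thesis
      using noncrossing_image[OF f set_lower_subset] d unfolding drawing_def by metis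
  qed
  ultimately show ?thesis unfolding drawing_def by blast
qed

lemma drawing_insert_gap:
  assumes d: "drawing n s ws e"
  obtains N s' ws' e' where "drawing n s' ws' e'" "map fst ws' = map fst ws" "N > 0"
    "\<And>c k. (c, k) \<in> set (labelled n s' ws' e') \<Longrightarrow> if c < m then k < 0 else 4 * N < k \<and> k < 5 * N"
proof -
  let ?L = "set (labelled n s ws e)"
  obtain B where B: "\<And>k. k \<in> snd ` ?L \<Longrightarrow> \<bar>k\<bar> < B" and "B > 0"
  proof -
    have "k \<in> snd ` ?L \<Longrightarrow> \<bar>k\<bar> < (\<Sum>k\<in>snd ` ?L. \<bar>k\<bar>) + 1" for k
      using member_le_sum[of k "snd ` ?L" abs] by simp
    moreover have "(\<Sum>k\<in>snd ` ?L. \<bar>k\<bar>) + 1 > 0" by (simp add: sum_nonneg add_nonneg_pos)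
    ultimately show ?thesis using that by blast
  qed
  \<comment> \<open>All places lie between -B and B. Shifting by -B makes the left ones negative,
    and shifting by 9B moves the others between 8B and 10B, which is the interval from 4N to 5N for
    N = 2B.\<close>
  define f where "f k = (if \<exists>c<m. (c, k) \<in> ?L then k - B else k + 9 * B)" for k
  have low: "(\<exists>c'<m. (c', k) \<in> ?L) \<longleftrightarrow> c < m" if "(c, k) \<in> ?L" for c k
    using that drawing_label_less[OF d, of _ k c k] by (metis le_less_trans less_irrefl not_le)
  have f: "strict_mono_on (snd ` ?L) f"
  proof (rule strict_mono_onI)
    fix k l assume kl: "k \<in> snd ` ?L" "l \<in> snd ` ?L" "k < l"
    then obtain c c' where cc: "(c, k) \<in> ?L" "(c', l) \<in> ?L" by auto
    have "c \<le> c'" using drawing_label_less[OF d cc(2,1)] kl(3) by force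
    then show "f k < f l"
      using low[OF cc(1)] low[OF cc(2)] kl(3) \<open>B > 0\<close> by (auto simp: f_def)
  qed
  show ?thesis
  proof (rule that[of "f s" "map (map_prod id (map_prod f f)) ws" "f e" "2 * B"])
    fix c k assume "(c, k) \<in> set (labelled n (f s) (map (map_prod id (map_prod f f)) ws) (f e))"
    then obtain l where l: "(c, l) \<in> ?L" "k = f l" unfolding labelled_map by auto
    then have "\<bar>l\<bar> < B" using B by force
    then show "if c < m then k < 0 else 4 * (2 * B) < k \<and> k < 5 * (2 * B)"
      using l low[OF l(1)] by (auto simp: f_def)
  qed (use drawing_map[OF d f] \<open>B > 0\<close> in \<open>auto simp: comp_def\<close>)
qed

text \<open>If the places left of the block of t_i are negative and all others lie between 4N and 5N,
  the half twist leaves the old places where they are and replaces the lower arc (y, z) of a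
  letter t_{i+1} by the path y, 8N - y, y - 4N, 6N - y, y - 2N, z, whose new places lie in the
  gap between 0 and 4N.\<close>

definition twist_crossing :: "nat \<Rightarrow> int \<Rightarrow> crossing \<Rightarrow> crossing list" where
  "twist_crossing i N = (\<lambda>(a, p, q).
     if fst a = i then [((Suc i, snd a), p, q)]
     else if fst a = Suc i then
       (if snd a
        then [((Suc i, False), p, 8 * N - p), ((i, True), p - 4 * N, 6 * N - p), ((Suc i, True),
            p - 2 * N, q)]
        else [((Suc i, False), p, q - 2 * N), ((i, False), 6 * N - q, q - 4 * N), ((Suc i, True),
            8 * N - q, q)])
     else [(a, p, q)])"

definition new_places :: "int \<Rightarrow> int \<Rightarrow> int set" where
  "new_places N y = {8 * N - y, y - 4 * N, 6 * N - y, y - 2 * N}"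

definition with_new_places :: "int \<Rightarrow> int set \<Rightarrow> int set" where
  "with_new_places N A = A \<union> (\<Union>y\<in>A \<inter> {4 * N<..<5 * N}. new_places N y)"

lemma map_fst_twist_crossing: "map fst (twist_crossing i N x) = half_twist i (fst x)"
  by (cases x) (auto simp: twist_crossing_def half_twist_def)

text \<open>The four maps in \<open>new_places\<close> send the interval (4N, 5N) injectively to
  (3N, 4N), (0, N), (N, 2N) and (2N, 3N). These are disjoint, so a new place determines the old
  place it comes from.\<close>

lemma with_new_places_disjoint:
  assumes "A \<inter> B = {}" "A \<union> B \<subseteq> {k. k < 0 \<or> 4 * N < k}" "N > 0"
  shows "with_new_places N A \<inter> with_new_places N B = {}"
proof -
  have old: "x \<notin> with_new_places N C - C" if "x < 0 \<or> 4 * N < x" for x and C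
    using that \<open>N > 0\<close> by (auto simp: with_new_places_def new_places_def)
  show ?thesis
  proof (rule ccontr)
    assume "with_new_places N A \<inter> with_new_places N B \<noteq> {}"
    then obtain x where x: "x \<in> with_new_places N A" "x \<in> with_new_places N B" by blast
    show False
    proof (cases "x < 0 \<or> 4 * N < x")
      case True
      then show False using old[of x] x assms(1) by blast
    next
      case False
      then have "x \<notin> A" "x \<notin> B" using assms(2) by auto
      then obtain y z where "x \<in> new_places N y" "y \<in> A \<inter> {4 * N<..<5 * N}"
        "x \<in> new_places N z" "z \<in> B \<inter> {4 * N<..<5 * N}"
        using x unfolding with_new_places_def by blast
      moreover from this assms(1) have "y \<noteq> z" by blast
      ultimately show False by (auto simp: new_places_def)
    qed
  qed
qed

definition places :: "crossing list \<Rightarrow> int list" where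
  "places ws = concat (map (\<lambda>(a, p, q). [p, q]) ws)"

lemma places_simps [simp]:
  "places [] = []" "places ((a, p, q) # ws) = p # q # places ws" "places (ws @ ws') = places ws @
      places ws'"
  by (simp_all add: places_def)

lemma map_snd_labelled: "map snd (labelled n s ws e) = s # places ws @ [e]"
  by (induction ws) (auto simp: labelled_def)

lemma twist_crossing_places:
  assumes "N > 0" "p \<noteq> q" "p < 0 \<or> 4 * N < p" "q < 0 \<or> 4 * N < q"
    and "fst a = Suc i \<Longrightarrow> (if snd a then p else q) \<in> {4 * N<..<5 * N}"
  shows "distinct (places (twist_crossing i N (a, p, q)))"
    "set (places (twist_crossing i N (a, p, q))) \<subseteq> with_new_places N {p, q}"
proof -
  show "distinct (places (twist_crossing i N (a, p, q)))"
    using assms by (auto simp: twist_crossing_def)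
  show "set (places (twist_crossing i N (a, p, q))) \<subseteq> with_new_places N {p, q}"
    using assms(5) by (auto simp: twist_crossing_def with_new_places_def new_places_def)
qed

lemma distinct_places_twist:
  assumes "distinct (places ws)" "set (places ws) \<subseteq> {k. k < 0 \<or> 4 * N < k}" "N > 0"
    and "\<And>a p q. (a, p, q) \<in> set ws \<Longrightarrow> fst a = Suc i \<Longrightarrow>
           (if snd a then p else q) \<in> {4 * N<..<5 * N}"
  shows "distinct (places (concat (map (twist_crossing i N) ws))) \<and>
    set (places (concat (map (twist_crossing i N) ws))) \<subseteq> with_new_places N (set (places ws))"
  using assms
proof (induction ws)
  case (Cons x ws)
  obtain a p q where x: "x = (a, p, q)" by (cases x) auto
  let ?t = "places (twist_crossing i N x)" and ?r = "places (concat (map (twist_crossing i N) ws))"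
  have IH: "distinct ?r" "set ?r \<subseteq> with_new_places N (set (places ws))"
    using Cons unfolding x by auto
  have pq: "p \<noteq> q" "p < 0 \<or> 4 * N < p" "q < 0 \<or> 4 * N < q"
    "fst a = Suc i \<Longrightarrow> (if snd a then p else q) \<in> {4 * N<..<5 * N}"
    using Cons.prems(1,2) Cons.prems(4)[of a p q] unfolding x by auto
  have t: "distinct ?t" "set ?t \<subseteq> with_new_places N {p, q}"
    using twist_crossing_places[OF Cons.prems(3) pq(1-3), of a i] pq(4) unfolding x by blast+
  have "with_new_places N {p, q} \<inter> with_new_places N (set (places ws)) = {}"
    by (rule with_new_places_disjoint) (use Cons.prems x in auto)
  then have "distinct (?t @ ?r)" using t IH by auto
  moreover have "with_new_places N {p, q} \<union> with_new_places N (set (places ws)) \<subseteq>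
      with_new_places N (set (places (x # ws)))"
    unfolding with_new_places_def x by auto
  then have "set (?t @ ?r) \<subseteq> with_new_places N (set (places (x # ws)))" using t IH by auto
  ultimately show ?case by simp
qed (simp add: places_def)

text \<open>Each replacement starts at the old \<open>p\<close> and ends at the old
  \<open>q\<close>, so old upper arcs survive. The new ones run inside a replacement, in a direction
  that depends on the sign of the letter; hence the converse relation.\<close>

lemma upper_twist:
  assumes "\<And>a p q. (a, p, q) \<in> set ws \<Longrightarrow> fst a = Suc i \<Longrightarrow> (if snd a then p else q) \<in> Y"
  shows "set (upper s (concat (map (twist_crossing i N) ws)) e) \<subseteq> set (upper s ws e) \<union>
     ((\<lambda>y. (y - 4 * N, 8 * N - y)) ` Y \<union> (\<lambda>y. (6 * N - y, y - 2 * N)) ` Y) \<union>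
     ((\<lambda>y. (y - 4 * N, 8 * N - y)) ` Y \<union> (\<lambda>y. (6 * N - y, y - 2 * N)) ` Y)\<inverse>"
  using assms
proof (induction ws arbitrary: s)
  case (Cons x ws)
  obtain a p q where x: "x = (a, p, q)" by (cases x) auto
  let ?T = "(\<lambda>y. (y - 4 * N, 8 * N - y)) ` Y \<union> (\<lambda>y. (6 * N - y, y - 2 * N)) ` Y"
  let ?r = "concat (map (twist_crossing i N) ws)"
  have IH: "set (upper q ?r e) \<subseteq> set (upper q ws e) \<union> ?T \<union> ?T\<inverse>"
    by (rule Cons.IH) (use Cons.prems in auto)
  have y: "fst a = Suc i \<Longrightarrow> (if snd a then p else q) \<in> Y" using Cons.prems[of a p q] x by simp
  have "set (upper s (twist_crossing i N x @ ?r) e) \<subseteq> insert (s, p) (?T \<union> ?T\<inverse> \<union> set (upper q ?r e))"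
    using y unfolding x twist_crossing_def by (auto split: if_splits)
  with IH show ?case unfolding x by auto
qed simp

text \<open>All new upper arcs are centred at 2N, hence concentric. They lie in the gap, which
  contains no endpoint of an old arc.\<close>

lemma noncrossing_upper_twist:
  fixes N :: int
  assumes nc: "noncrossing U" and U: "U \<subseteq> {k. k < 0 \<or> 4 * N < k} \<times> {k. k < 0 \<or> 4 * N < k}"
    and Y: "\<And>y. y \<in> Y \<Longrightarrow> 4 * N < y \<and> y < 5 * N"
  shows "noncrossing (U \<union> ((\<lambda>y. (y - 4 * N, 8 * N - y)) ` Y \<union> (\<lambda>y. (6 * N - y, y - 2 * N)) ` Y))"
    (is "noncrossing (U \<union> ?T)")
proof -
  have T: "0 < a \<and> a < 4 * N \<and> 0 < b \<and> b < 4 * N" if "(a, b) \<in> ?T" for a b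
    using that by (auto dest!: Y)
  have U': "(a < 0 \<or> 4 * N < a) \<and> (b < 0 \<or> 4 * N < b)" if "(a, b) \<in> U" for a b
    using that U by auto
  have TT: "between a b c \<longleftrightarrow> between a b d" if abcd: "(a, b) \<in> ?T" "(c, d) \<in> ?T" for a b c d
  proof -
    obtain y z where "y \<in> Y" "z \<in> Y" "(a, b) = (y - 4 * N, 8 * N - y) \<or> (a, b) = (6 * N - y,
        y - 2 * N)"
      "(c, d) = (z - 4 * N, 8 * N - z) \<or> (c, d) = (6 * N - z, z - 2 * N)"
      using abcd by blast
    moreover from this Y[of y] Y[of z] have "4 * N < y" "y < 5 * N" "4 * N < z" "z < 5 * N" by auto
    ultimately show ?thesis unfolding between_def by auto
  qed
  have UT: "between a b c \<longleftrightarrow> between a b d" "between c d a \<longleftrightarrow> between c d b"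
    if "(a, b) \<in> U" "(c, d) \<in> ?T" for a b c d
    using T[OF that(2)] U'[OF that(1)] unfolding between_def by (smt (verit))+
  show ?thesis
    unfolding noncrossing_def
  proof (clarify, goal_cases)
    case (1 a b c d)
    then show ?case
      using noncrossingD[OF nc, of a b c d] TT[of a b c d] UT(1)[of a b c d] UT(2)[of c d a b]
          by blast
  qed
qed


text \<open>The new arcs at \<open>y\<close> are centred at 4N, those at \<open>y - 4 * N\<close> at
  N, and those ending at \<open>z\<close> enclose the ones centred at 4N. As every \<open>y\<close>
  lies left of every \<open>z\<close>, the arcs of \<open>R\<close> form a single nest, which
  survives translating the left ends. An arc of \<open>S\<close> right of the gap lies, for each
  \<open>(y, z)\<close>, either left of \<open>y\<close>, inside the arcs ending at \<open>y\<close>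
  and \<open>z\<close>, or beyond \<open>z\<close>.\<close>

lemma noncrossing_lower_twist:
  fixes N :: int
  assumes S: "\<And>p q. (p, q) \<in> S \<Longrightarrow> (p < 0 \<and> q < 0) \<or> (4 * N < p \<and> 4 * N < q \<and>
              (\<forall>(y, z)\<in>R. (p < y \<and> q < y) \<or> (z < p \<and> z < q)))"
    and R: "\<And>y z y' z'. (y, z) \<in> R \<Longrightarrow> (y', z') \<in> R \<Longrightarrow> 4 * N < y \<and> y < z \<and> y < z' \<and> y < 5 * N"
    and nc: "noncrossing S" "noncrossing R"
  shows "noncrossing (S \<union> (\<lambda>(y, z). (8 * N - y, y)) ` R \<union> (\<lambda>(y, z). (y - 4 * N, 6 * N - y)) ` R \<union>
     (\<lambda>(y, z). (y - 2 * N, z)) ` R)" (is "noncrossing ?T")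
proof -
  have RR: "y = y' \<and> z = z' \<or> y < y' \<and> z' < z \<or> y' < y \<and> z < z'"
    if "(y, z) \<in> R" "(y', z') \<in> R" for y z y' z'
    using noncrossingD[OF nc(2) that] noncrossingD[OF nc(2) that(2,1)] R[OF that] R[OF that(2,1)]
    unfolding between_def by (smt (verit))
  have RT: "between a b c \<longleftrightarrow> between a b d"
    if "(y, z) \<in> R" "(y', z') \<in> R"
      "(a, b) \<in> {(8 * N - y, y), (y - 4 * N, 6 * N - y), (y - 2 * N, z)}"
      "(c, d) \<in> {(8 * N - y', y'), (y' - 4 * N, 6 * N - y'), (y' - 2 * N, z')}"
          for a b c d y z y' z'
    using that(3,4) RR[OF that(1,2)] R[OF that(1,2)] R[OF that(2,1)]
    unfolding between_def by (elim insertE emptyE; simp; smt (verit))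
  have ST: "between a b c \<longleftrightarrow> between a b d" "between c d a \<longleftrightarrow> between c d b"
    if "(a, b) \<in> S" "(y, z) \<in> R" "(c, d) \<in> {(8 * N - y, y), (y - 4 * N, 6 * N - y), (y - 2 * N, z)}"
    for a b c d y z
    using that(3) S[OF that(1)] that(2) R[OF that(2,2)]
    unfolding between_def by (elim insertE emptyE; force)+
  have T: "(a, b) \<in> S \<or> (\<exists>y z. (y, z) \<in> R \<and> (a, b) \<in> {(8 * N - y, y), (y - 4 * N, 6 * N - y),
      (y - 2 * N, z)})"
    if "(a, b) \<in> ?T" for a b
    using that by auto
  show ?thesis
    unfolding noncrossing_def
  proof (clarify, goal_cases)
    case (1 a b c d)
    from T[OF 1(1)] T[OF 1(2)] show ?case
      using noncrossingD[OF nc(1), of a b c d] RT[of _ _ _ _ a b c d] ST(1)[of a b _ _ c d]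
          ST(2)[of c d _ _ a b]
      by meson
  qed
qed

lemma code_bounds: "2 * fst a - 1 \<le> code a" "code a \<le> 2 * fst a"
  by (simp_all add: code_def)

lemma noncrossing_twist_lower_arcs:
  assumes d: "drawing n s ws e" and i: "1 \<le> i"
    and gap: "\<And>c k. (c, k) \<in> set (labelled n s ws e) \<Longrightarrow>
      if c < 2 * i - 1 then k < 0 else 4 * N < k \<and> k < 5 * N"
  shows "noncrossing (snd ` set (concat (map (twist_crossing i N) ws)))"
proof -
  let ?L = "set (labelled n s ws e)"
  \<comment> \<open>Lower arcs of t_{i+1} and of its inverse, oriented from the block of t_{i+1} to
    that of the inverse whichever way the word runs.\<close>
  define R where "R = {(y, z). ((Suc i, True), y, z) \<in> set ws \<or> ((Suc i, False), z, y) \<in> set ws}"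
  define S where "S = {(p, q). \<exists>a. (a, p, q) \<in> set ws \<and> fst a \<noteq> Suc i}"
  have nc: "noncrossing (snd ` set ws)" using d unfolding drawing_def by blast
  have RL: "(2 * i + 1, y) \<in> ?L" "(2 * i + 2, z) \<in> ?L" if "(y, z) \<in> R" for y z
    using that labelled_crossing[of "(Suc i, True)" y z ws n s e] labelled_crossing[of "(Suc i,
        False)" z y ws n s e]
    by (auto simp: R_def code_def inv_letter_def)
  let ?T = "S \<union> (\<lambda>(y, z). (8 * N - y, y)) ` R \<union> (\<lambda>(y, z). (y - 4 * N, 6 * N - y)) ` R \<union>
     (\<lambda>(y, z). (y - 2 * N, z)) ` R"
  have "noncrossing ?T"
  proof (rule noncrossing_lower_twist)
    fix p q assume "(p, q) \<in> S"
    then obtain a where a: "(a, p, q) \<in> set ws" "fst a \<noteq> Suc i" by (auto simp: S_def)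
    note La = labelled_crossing[OF a(1), of n s e]
    note b = code_bounds[of a] code_bounds[of "inv_letter a"]
    consider "fst a < i" | "fst a = i" | "Suc i < fst a" using a(2) by linarith
    then show "(p < 0 \<and> q < 0) \<or> (4 * N < p \<and> 4 * N < q \<and>
              (\<forall>(y, z)\<in>R. (p < y \<and> q < y) \<or> (z < p \<and> z < q)))"
    proof cases
      case 1
      then have "code a < 2 * i - 1" "code (inv_letter a) < 2 * i - 1" using b by auto
      then show ?thesis using gap[OF La(1)] gap[OF La(2)] by auto
    next
      case 2
      then have "\<not> code a < 2 * i - 1" "\<not> code (inv_letter a) < 2 * i - 1"
        "code a < 2 * i + 1" "code (inv_letter a) < 2 * i + 1" using b by auto
      then show ?thesis
        using gap[OF La(1)] gap[OF La(2)] drawing_label_less[OF d La(1) RL(1)]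
          drawing_label_less[OF d La(2) RL(1)] by auto
    next
      case 3
      then have "2 * i + 2 < code a" "2 * i + 2 < code (inv_letter a)" using b by auto
      then show ?thesis
        using gap[OF La(1)] gap[OF La(2)] drawing_label_less[OF d RL(2) La(1)]
          drawing_label_less[OF d RL(2) La(2)] by auto
    qed
  next
    fix y z y' z' assume R: "(y, z) \<in> R" "(y', z') \<in> R"
    show "4 * N < y \<and> y < z \<and> y < z' \<and> y < 5 * N"
      using gap[OF RL(1)[OF R(1)]] drawing_label_less[OF d RL(1)[OF R(1)] RL(2)[OF R(1)]]
        drawing_label_less[OF d RL(1)[OF R(1)] RL(2)[OF R(2)]] by auto
  next
    show "noncrossing S"
      by (rule noncrossing_subset[OF nc]) (force simp: S_def)
    show "noncrossing R"
      by (rule noncrossing_unoriented[OF nc]) (force simp: R_def)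
  qed
  have step: "snd ` set (twist_crossing i N x) \<subseteq> ?T \<union> ?T\<inverse>" if x: "x \<in> set ws" for x
  proof -
    obtain k b p q where x_eq: "x = ((k, b), p, q)" by (metis prod.exhaust)
    show ?thesis
    proof (cases "k = Suc i")
      case False
      then have "(p, q) \<in> S" using x unfolding x_eq S_def by force
      then show ?thesis using False unfolding x_eq by (auto simp: twist_crossing_def)
    next
      case True
      show ?thesis
      proof (cases b)
        case b: True
        then have "(p, q) \<in> R" using x True unfolding x_eq R_def by simp
        then show ?thesis using True b unfolding x_eq by (force simp: twist_crossing_def)
      next
        case b: False
        then have "(q, p) \<in> R" using x True unfolding x_eq R_def by simp
        then show ?thesis using True b unfolding x_eq by (force simp: twist_crossing_def)
      qed
    qed
  qed
  have "snd ` set (concat (map (twist_crossing i N) ws)) =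
      (\<Union>x\<in>set ws. snd ` set (twist_crossing i N x))"
    by auto
  also have "\<dots> \<subseteq> ?T \<union> ?T\<inverse>" by (rule UN_least) (rule step)
  finally have "snd ` set (concat (map (twist_crossing i N) ws)) \<subseteq> ?T \<union> ?T\<inverse>" .
  with \<open>noncrossing ?T\<close> show ?thesis by (rule noncrossing_unoriented)
qed

text \<open>The half twist moves the old places of the block of t_i into that of t_{i+1}, and the
  old places of the next three blocks into that of the inverse of t_{i+1}.\<close>
definition twist_label :: "nat \<Rightarrow> nat \<Rightarrow> nat" where
  "twist_label i c =
     (if c < 2 * i - 1 \<or> 2 * i + 2 < c then c
      else if c = 2 * i - 1 then 2 * i + 1 else 2 * i + 2)"

text \<open>From left to right, the quarters of the gap carry the labels 2i-1, 2i, 2i+1 and 2i+1.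
  The old block of t_i, now labelled 2i+1, comes next, followed by the old places now labelled 2i+2;
  the outer labels do not change.\<close>

lemma labels_twist_less:
  assumes d: "drawing n s ws e" and i: "1 \<le> i" "Suc i \<le> n"
    and gap: "\<And>c k. (c, k) \<in> set (labelled n s ws e) \<Longrightarrow>
      if c < 2 * i - 1 then k < 0 else 4 * N < k \<and> k < 5 * N"
    and ck: "(c, k) \<in> set (labelled n s (concat (map (twist_crossing i N) ws)) e)"
      "(c', l) \<in> set (labelled n s (concat (map (twist_crossing i N) ws)) e)" "c < c'"
  shows "k < l"
proof -
  let ?L = "set (labelled n s ws e)"
  define New where "New y = {(2 * i - 1, y - 4 * N), (2 * i, 6 * N - y), (2 * i + 1, y - 2 * N),
      (2 * i + 1, 8 * N - y)}" for y
  define G where "G = map_prod (twist_label i) id ` ?L \<union> (\<Union>y\<in>{y. (2 * i + 1, y) \<in> ?L}. New y)"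
  have tl: "twist_label i (2 * i - Suc 0) = Suc (2 * i)" "twist_label i (2 * i) = Suc (Suc (2 * i))"
    "twist_label i (Suc (2 * i)) = Suc (Suc (2 * i))"
    "twist_label i (Suc (Suc (2 * i))) = Suc (Suc (2 * i))"
    using i(1) by (auto simp: twist_label_def)
  have "(code (fst x'), fst (snd x')) \<in> G \<and> (code (inv_letter (fst x')), snd (snd x')) \<in> G"
    if x: "x \<in> set ws" "x' \<in> set (twist_crossing i N x)" for x x'
  proof -
    obtain j b p q where x_eq: "x = ((j, b), p, q)" by (metis prod.exhaust)
    have "(code (j, b), p) \<in> ?L" "(code (j, \<not> b), q) \<in> ?L"
      using labelled_crossing[of "(j, b)" p q ws n s e] x(1) unfolding x_eq
          by (auto simp: inv_letter_def)
    then have old: "(twist_label i (code (j, b)), p) \<in> G" "(twist_label i (code (j, \<not> b)), q) \<in> G"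
      and new: "\<And>v. b \<Longrightarrow> code (j, b) = 2 * i + 1 \<Longrightarrow> v \<in> New p \<Longrightarrow> v \<in> G"
        "\<And>v. \<not> b \<Longrightarrow> code (j, \<not> b) = 2 * i + 1 \<Longrightarrow> v \<in> New q \<Longrightarrow> v \<in> G"
      unfolding G_def by force+
    have j: "1 \<le> j" using drawing_letter[OF d] x(1) unfolding x_eq by force
    consider "j = i" | "j = Suc i" b | "j = Suc i" "\<not> b" | "j \<noteq> i" "j \<noteq> Suc i" by blast
    then show ?thesis
    proof cases
      case 1
      then show ?thesis
        using x(2) old i(1) unfolding x_eq
        by (cases b) (auto simp: twist_crossing_def code_def inv_letter_def tl)
    next
      case 2
      then have "New p \<subseteq> G" using new(1) by (auto simp: code_def)
      then show ?thesis
        using x(2) old 2 unfolding x_eq New_def insert_subset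
        by (auto simp: twist_crossing_def code_def inv_letter_def tl)
    next
      case 3
      then have "New q \<subseteq> G" using new(2) by (auto simp: code_def)
      then show ?thesis
        using x(2) old 3 unfolding x_eq New_def insert_subset
        by (auto simp: twist_crossing_def code_def inv_letter_def tl)
    next
      case 4
      then have "code (j, b) < 2 * i - 1 \<or> 2 * i + 2 < code (j, b)"
        "code (j, \<not> b) < 2 * i - 1 \<or> 2 * i + 2 < code (j, \<not> b)" 
        using j i(1) by (auto simp: code_def)
      then show ?thesis
        using x(2) old 4 unfolding x_eq
        by (auto simp: twist_crossing_def inv_letter_def twist_label_def)
    qed
  qed
  moreover have "(0, s) \<in> G" "(2 * n + 1, e) \<in> G"
  proof -
    have "(twist_label i 0, s) \<in> G" "(twist_label i (2 * n + 1), e) \<in> G"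
      unfolding G_def set_labelled by force+
    then show "(0, s) \<in> G" "(2 * n + 1, e) \<in> G" using i by (auto simp: twist_label_def)
  qed
  ultimately have "set (labelled n s (concat (map (twist_crossing i N) ws)) e) \<subseteq> G"
    unfolding set_labelled by auto
  then have G: "(c, k) \<in> G" "(c', l) \<in> G" using ck by auto
  have cases: "(\<exists>b. c = twist_label i b \<and> (b, k) \<in> ?L) \<or>
      (\<exists>y. 4 * N < y \<and> y < 5 * N \<and> (c, k) \<in> New y)" if "(c, k) \<in> G" for c k
    using that gap unfolding G_def by force
  have new: "2 * i - 1 \<le> c \<and> c \<le> 2 * i + 1 \<and> 0 < k \<and> k < 4 * N"
    if "4 * N < y" "y < 5 * N" "(c, k) \<in> New y" for c k y
    using that i unfolding New_def by auto
  from cases[OF G(1)] cases[OF G(2)] show ?thesis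
  proof (elim disjE exE conjE)
    fix b b' assume b: "c = twist_label i b" "(b, k) \<in> ?L" "c' = twist_label i b'" "(b', l) \<in> ?L"
    \<comment> \<open>\<open>twist_label i\<close> is weakly increasing.\<close>
    then have "b < b'" using ck(3) by (auto simp: twist_label_def split: if_splits)
    then show ?thesis using drawing_label_less[OF d] b by blast
  next
    fix b y assume b: "c = twist_label i b" "(b, k) \<in> ?L" and y: "4 * N < y" "y < 5 * N" "(c',
        l) \<in> New y"
    have "b < 2 * i - 1" using ck(3) b(1) new[OF y] by (auto simp: twist_label_def split: if_splits)
    then show ?thesis using gap[OF b(2)] new[OF y] by simp
  next
    fix b y assume b: "c' = twist_label i b" "(b, l) \<in> ?L" and y: "4 * N < y" "y < 5 * N" "(c,
        k) \<in> New y"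
    have "\<not> b < 2 * i - 1" using ck(3) b(1) new[OF y]
        by (auto simp: twist_label_def split: if_splits)
    then show ?thesis using gap[OF b(2)] new[OF y] by simp
  next
    fix y z assume "4 * N < y" "y < 5 * N" "(c, k) \<in> New y" "4 * N < z" "z < 5 * N" "(c',
        l) \<in> New z"
    then show ?thesis using ck(3) i unfolding New_def by auto
  qed
qed

lemma drawing_twist:
  assumes d: "drawing n s ws e" and i: "1 \<le> i" "Suc i \<le> n" and N: "N > 0"
    and gap: "\<And>c k. (c, k) \<in> set (labelled n s ws e) \<Longrightarrow>
      if c < 2 * i - 1 then k < 0 else 4 * N < k \<and> k < 5 * N"
  shows "drawing n s (concat (map (twist_crossing i N) ws)) e"
proof -
  let ?L = "set (labelled n s ws e)" and ?ws = "concat (map (twist_crossing i N) ws)"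
  have out: "k < 0 \<or> 4 * N < k" if k: "k \<in> snd ` ?L" for k
  proof -
    obtain c where "(c, k) \<in> ?L" using k by auto
    from gap[OF this] show ?thesis by (auto split: if_splits)
  qed
  define Y where "Y = {y. (2 * i + 1, y) \<in> ?L}"
  have Y: "4 * N < y \<and> y < 5 * N" if "y \<in> Y" for y
    using gap[of "2 * i + 1" y] that by (simp add: Y_def)
  have Yin: "(if snd a then p else q) \<in> Y" if "(a, p, q) \<in> set ws" "fst a = Suc i" for a p q
    using labelled_crossing[OF that(1), of n s e] that(2)
        by (cases a) (auto simp: Y_def code_def inv_letter_def)
  have "fst ` set ?ws \<subseteq> {1..n} \<times> UNIV"
  proof -
    have "fst ` set (twist_crossing i N x) \<subseteq> {1..n} \<times> UNIV" if "x \<in> set ws" for x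
      using drawing_letter[OF d, of "fst x" "fst (snd x)" "snd (snd x)"] that i
      by (cases x) (auto simp: twist_crossing_def)
    then show ?thesis unfolding set_concat set_map image_Union image_image by (rule UN_least)
  qed
  moreover have "distinct (map snd (labelled n s ?ws e))"
  proof -
    have L: "snd ` ?L = insert s (insert e (set (places ws)))"
      using arg_cong[OF map_snd_labelled[of n s ws e], of set] by auto
    have se: "s < 0" "4 * N < e" using gap[of 0 s] gap[of "2 * n + 1" e] i
        by (auto simp: set_labelled)
    have dist: "distinct (s # places ws @ [e])"
      using d unfolding drawing_def map_snd_labelled by blast
    have "distinct (places ?ws) \<and> set (places ?ws) \<subseteq> with_new_places N (set (places ws))"
      by (rule distinct_places_twist) (use dist out L N Yin Y in auto)
    moreover have "s \<notin> with_new_places N (set (places ws))"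
        "e \<notin> with_new_places N (set (places ws))"
      using se dist N by (auto simp: with_new_places_def new_places_def)
    ultimately show ?thesis using dist unfolding map_snd_labelled by auto
  qed
  moreover have "noncrossing (set (upper s ?ws e))"
  proof (rule noncrossing_unoriented)
    show "noncrossing (set (upper s ws e) \<union> ((\<lambda>y. (y - 4 * N, 8 * N - y)) ` Y \<union> (\<lambda>y. (6 * N - y,
        y - 2 * N)) ` Y))"
      (is "noncrossing ?T")
    proof (rule noncrossing_upper_twist)
      show "noncrossing (set (upper s ws e))" using d unfolding drawing_def by blast
      show "set (upper s ws e) \<subseteq> {k. k < 0 \<or> 4 * N < k} \<times> {k. k < 0 \<or> 4 * N < k}"
        using set_upper_subset[of s ws e n] out by blast
    qed (rule Y)
    show "set (upper s ?ws e) \<subseteq> ?T \<union> ?T\<inverse>"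
      using upper_twist[of ws i Y s N e] Yin by blast
  qed
  ultimately show ?thesis
    using noncrossing_twist_lower_arcs[OF d i(1) gap] labels_twist_less[OF d i gap]
    unfolding drawing_def by blast
qed

lemma drawable_half_twist:
  assumes "drawable n w" "1 \<le> i" "Suc i \<le> n"
  shows "drawable n (concat (map (half_twist i) w))"
proof -
  obtain s ws e where d: "drawing n s ws e" and w: "map fst ws = w"
    using assms(1) unfolding drawable_def by blast
  obtain N s' ws' e' where d': "drawing n s' ws' e'" and ws': "map fst ws' = map fst ws" and N:
      "N > 0"
    and gap: "\<And>c k. (c, k) \<in> set (labelled n s' ws' e') \<Longrightarrow>
      if c < 2 * i - 1 then k < 0 else 4 * N < k \<and> k < 5 * N"
    by (rule drawing_insert_gap[OF d, where m = "2 * i - 1"]) blast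
  have "drawing n s' (concat (map (twist_crossing i N) ws')) e'"
    by (rule drawing_twist[OF d' assms(2,3) N gap])
  moreover have "map fst (concat (map (twist_crossing i N) ws')) =
      concat (map (half_twist i) (map fst ws'))"
    by (simp add: map_concat comp_def map_fst_twist_crossing)
  ultimately show ?thesis unfolding drawable_def using ws' w by metis
qed


text \<open>Reversing words and exchanging t_i with t_{n+1-i} reflects the picture in a vertical line
  and turns half twists into inverse half twists.\<close>
definition mirror :: "nat \<Rightarrow> letter \<Rightarrow> letter" where
  "mirror n a = (Suc n - fst a, snd a)"

lemma noncrossing_reflect:
  "noncrossing S \<Longrightarrow> noncrossing ((\<lambda>(x, y). (- y, - x)) ` S)" for S :: "(int \<times> int) set"
  unfolding noncrossing_def between_def by fastforce

text \<open>The reflection c -> 2n+1-c exchanges the block of t_j with that of the inverse of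
  t_{n+1-j}. Reading the word backwards exchanges the two places of each crossing, so the sign of
  the letter is restored.\<close>

lemma labelled_mirror:
  assumes "fst ` set ws \<subseteq> {1..n} \<times> UNIV"
  shows "labelled n (- e) (rev (map (\<lambda>(a, p, q). (mirror n a, - q, - p)) ws)) (- s) =
    rev (map (\<lambda>(c, k). (2 * n + 1 - c, - k)) (labelled n s ws e))"
proof -
  let ?f = "\<lambda>(a, p, q). [(code a, p), (code (inv_letter a), q)]"
  let ?r = "\<lambda>(c, k). (2 * n + 1 - c, - k)"
  have "?f (mirror n a, - q, - p) = rev (map ?r (?f (a, p, q)))" if "(a, p, q) \<in> set ws" for a
      and p q :: int
  proof -
    have "fst a \<in> {1..n}" using assms that by force
    then show ?thesis by (cases a) (auto simp: code_def inv_letter_def mirror_def)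
  qed
  then have *: "map (\<lambda>(a, p, q). ?f (mirror n a, - q, - p)) ws = map (\<lambda>x. rev (map ?r (?f x))) ws"
    by (intro map_cong) auto
  have "concat (map ?f (rev (map (\<lambda>(a, p, q). (mirror n a, - q, - p)) ws))) =
      concat (rev (map (\<lambda>(a, p, q). ?f (mirror n a, - q, - p)) ws))"
    by (simp add: rev_map comp_def case_prod_unfold)
  also have "\<dots> = rev (map ?r (concat (map ?f ws)))"
    unfolding * by (simp add: rev_concat map_concat rev_map comp_def)
  finally show ?thesis unfolding labelled_def by simp
qed

lemma drawing_mirror:
  assumes d: "drawing n s ws e"
  shows "drawing n (- e) (rev (map (\<lambda>(a, p, q). (mirror n a, - q, - p)) ws)) (- s)"
proof -
  let ?ws = "rev (map (\<lambda>(a, p, q). (mirror n a, - q, - p)) ws)"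
  let ?L = "labelled n s ws e" and ?L' = "labelled n (- e) ?ws (- s)"
  have range: "fst ` set ws \<subseteq> {1..n} \<times> UNIV" using d unfolding drawing_def by blast
  note L' = labelled_mirror[OF range, of e s]
  have "fst ` set ?ws \<subseteq> {1..n} \<times> UNIV"
    using range by (force simp: mirror_def)
  moreover have "map snd ?L' = rev (map uminus (map snd ?L))"
    unfolding L' by (simp add: rev_map comp_def case_prod_unfold)
  then have "distinct (map snd ?L')"
    using d unfolding drawing_def by (metis distinct_map distinct_rev inj_uminus)
  moreover have "k < l" if kl: "(c, k) \<in> set ?L'" "(c', l) \<in> set ?L'" "c < c'" for c k c' l
  proof -
    obtain b b' where "(b, - k) \<in> set ?L" "c = 2 * n + 1 - b" "(b', - l) \<in> set ?L" "c' =
        2 * n + 1 - b'"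
      using kl(1,2) unfolding L' by auto
    then show ?thesis using drawing_label_less[OF d, of b' "- l" b "- k"] kl(3) by auto
  qed
  moreover have "upper (- e) ?ws (- s) = rev (map (\<lambda>(x, y). (- y, - x)) (upper s ws e))"
    by (induction ws arbitrary: s) (auto simp: upper_append)
  then have "noncrossing (set (upper (- e) ?ws (- s)))"
    using noncrossing_reflect[of "set (upper s ws e)"] d unfolding drawing_def by simp
  moreover have "snd ` set ?ws = (\<lambda>(x, y). (- y, - x)) ` snd ` set ws" by force
  then have "noncrossing (snd ` set ?ws)"
    using noncrossing_reflect[of "snd ` set ws"] d unfolding drawing_def by simp
  ultimately show ?thesis unfolding drawing_def by blast
qed

lemma drawable_mirror: "drawable n w \<Longrightarrow> drawable n (rev (map (mirror n) w))"
proof -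
  assume "drawable n w"
  then obtain s ws e where d: "drawing n s ws e" and w: "map fst ws = w"
    unfolding drawable_def by blast
  have "map fst (rev (map (\<lambda>(a, p, q). (mirror n a, - q, - p)) ws)) = rev (map (mirror n) w)"
    unfolding w[symmetric] by (simp add: rev_map comp_def case_prod_unfold)
  with drawing_mirror[OF d] show ?thesis unfolding drawable_def by blast
qed

definition half_twist_inv :: "nat \<Rightarrow> letter \<Rightarrow> word" where
  "half_twist_inv i a =
     (if fst a = Suc i then [(i, snd a)]
      else if fst a = i then [(i, True), (Suc i, snd a), (i, False)]
      else [a])"

lemma drawable_letters: "drawable n w \<Longrightarrow> set w \<subseteq> {1..n} \<times> UNIV"
  unfolding drawable_def drawing_def by force

lemma drawable_half_twist_inv:
  assumes w: "drawable n w" and i: "1 \<le> i" "Suc i \<le> n"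
  shows "drawable n (concat (map (half_twist_inv i) w))"
proof -
  let ?m = "\<lambda>w. rev (map (mirror n) w)"
  \<comment> \<open>The mirror takes the indices i and i+1 to n+1-i and n-i, which are exchanged by
    the half twist with index n-i.\<close>
  have "half_twist_inv i a = ?m (half_twist (n - i) (mirror n a))" if "a \<in> set w" for a
  proof -
    have "fst a \<in> {1..n}" using drawable_letters[OF w] that by force
    then show ?thesis
      using i by (cases a) (auto simp: half_twist_inv_def half_twist_def mirror_def)
  qed
  then have "concat (map (half_twist_inv i) w) = concat (map (\<lambda>a. ?m (half_twist (n - i) (mirror n
      a))) w)"
    by (metis (mono_tags, lifting) map_cong)
  also have "\<dots> = ?m (concat (map (half_twist (n - i)) (?m w)))"
    by (simp add: rev_concat map_concat rev_map comp_def)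
  also have "drawable n \<dots>"
    by (intro drawable_mirror drawable_half_twist w) (use i in auto)
  finally show ?thesis .
qed

section \<open>Artin's reduction\<close>

definition letter_image :: "(nat \<Rightarrow> word) \<Rightarrow> letter \<Rightarrow> word" where
  "letter_image u a = (if snd a then u (fst a) else fg_inv (u (fst a)))"

definition word_image :: "(nat \<Rightarrow> word) \<Rightarrow> word \<Rightarrow> word" where
  "word_image u w = concat (map (letter_image u) w)"

lemma word_image_simps [simp]:
  "word_image u [] = []" "word_image u (a # w) = letter_image u a @ word_image u w"
  "word_image u (v @ w) = word_image u v @ word_image u w"
  by (simp_all add: word_image_def)

lemma letter_image_inv_letter: "letter_image u (inv_letter a) = fg_inv (letter_image u a)"
  by (simp add: letter_image_def inv_letter_def)

lemma word_image_fg_inv: "word_image u (fg_inv w) = fg_inv (word_image u w)"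
  by (induction w) (simp_all add: letter_image_inv_letter)

lemma word_image_cong:
  assumes "\<And>i. i \<in> fst ` set w \<Longrightarrow> u i \<simeq> v i"
  shows "word_image u w \<simeq> word_image v w"
  unfolding word_image_def
proof (rule freely_equal_concat_map)
  fix a assume "a \<in> set w"
  then have "u (fst a) \<simeq> v (fst a)" using assms by blast
  from this freely_equal_fg_inv[OF this] show "letter_image u a \<simeq> letter_image v a"
    unfolding letter_image_def by (cases "snd a") simp_all
qed

lemma word_image_concat_map:
  assumes "\<And>a. a \<in> set w \<Longrightarrow> word_image u (f a) \<simeq> letter_image v a"
  shows "word_image u (concat (map f w)) \<simeq> word_image v w"
proof -
  have "word_image u (concat (map f w)) = concat (map (\<lambda>a. word_image u (f a)) w)"
    by (induction w) simp_all
  then show ?thesis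
    using freely_equal_concat_map[of w "\<lambda>a. word_image u (f a)" "letter_image v"] assms
    unfolding word_image_def by metis
qed

text \<open>Trades a twist of the word for a change of the substituted tuple. The tuples are
  compared only at indices occurring in \<open>w\<close>, because they will be read off lists that
  have entries for the indices 1 to n only.\<close>

lemma word_image_half_twist:
  assumes "v i = u (Suc i)" "v (Suc i) \<simeq> fg_inv (u (Suc i)) @ u i @ u (Suc i)"
    and "\<And>k. k \<in> fst ` set w \<Longrightarrow> k \<noteq> i \<Longrightarrow> k \<noteq> Suc i \<Longrightarrow> v k = u k"
  shows "word_image u (concat (map (half_twist i) w)) \<simeq> word_image v w"
proof (rule word_image_concat_map)
  fix a assume a: "a \<in> set w"
  have "fg_inv (v (Suc i)) \<simeq> fg_inv (u (Suc i)) @ fg_inv (u i) @ u (Suc i)"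
    using freely_equal_fg_inv[OF assms(2)] by simp
  then show "word_image u (half_twist i a) \<simeq> letter_image v a"
    using assms(1,2) assms(3)[of "fst a"] a unfolding half_twist_def letter_image_def
        word_image_def by auto
qed

lemma word_image_half_twist_inv:
  assumes "v (Suc i) = u i" "v i \<simeq> u i @ u (Suc i) @ fg_inv (u i)"
    and "\<And>k. k \<in> fst ` set w \<Longrightarrow> k \<noteq> i \<Longrightarrow> k \<noteq> Suc i \<Longrightarrow> v k = u k"
  shows "word_image u (concat (map (half_twist_inv i) w)) \<simeq> word_image v w"
proof (rule word_image_concat_map)
  fix a assume a: "a \<in> set w"
  have "fg_inv (v i) \<simeq> u i @ fg_inv (u (Suc i)) @ fg_inv (u i)"
    using freely_equal_fg_inv[OF assms(2)] by simp
  then show "word_image u (half_twist_inv i a) \<simeq> letter_image v a"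
    using assms(1,2) assms(3)[of "fst a"] a unfolding half_twist_inv_def letter_image_def
        word_image_def by auto
qed

section \<open>Products of conjugates of generators\<close>

definition conj_gen :: "nat \<times> word \<Rightarrow> word" where
  "conj_gen p = fg_inv (snd p) @ (fst p, True) # snd p"

lemma reduced_conj_genD:
  assumes "reduced (conj_gen (k, g))"
  shows "reduced g" "reduced ((k, True) # g)" "reduced (fg_inv g @ [(k, True)])" "g = [] \<or>
      hd g \<noteq> (k, True)"
proof -
  show 1: "reduced g" "reduced ((k, True) # g)" 
    using assms unfolding conj_gen_def by (auto simp: reduced_append reduced_Cons)
  show 2: "reduced (fg_inv g @ [(k, True)])"
    using assms unfolding conj_gen_def by (auto simp: reduced_append reduced_Cons)
  show "g = [] \<or> hd g \<noteq> (k, True)"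
    using 2 by (cases g) (auto simp: reduced_append)
qed

lemma conj_gen_shorten:
  assumes "\<not> reduced (conj_gen (k, g))"
  obtains h where "length h < length g" "conj_gen (k, h) \<simeq> conj_gen (k, g)"
proof (cases "reduced g")
  case False
  have "conj_gen (k, reduce g) \<simeq> conj_gen (k, g)"
  proof -
    have "fg_inv (reduce g) @ [(k, True)] @ reduce g \<simeq> fg_inv g @ [(k, True)] @ g"
      by (intro freely_equal_append freely_equal_fg_inv) simp_all
    then show ?thesis by (simp add: conj_gen_def)
  qed
  then show ?thesis using that[of "reduce g"] length_reduce_less[OF False] by blast
next
  case True
  then obtain b h where g: "g = (k, b) # h"
    using assms reduced_fg_inv[OF True]
    by (cases g) (auto simp: conj_gen_def reduced_append reduced_Cons inv_letter_def)
  have "[(k, \<not> b), (k, True), (k, b)] \<simeq> [(k, True)]"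
    by (cases b) (simp_all add: inv_letter_def)
  then have "fg_inv h @ [(k, \<not> b), (k, True), (k, b)] @ h \<simeq> fg_inv h @ [(k, True)] @ h"
    by (intro freely_equal_append refl)
  then have "conj_gen (k, h) \<simeq> conj_gen (k, g)" by (simp add: conj_gen_def g inv_letter_def)
  then show ?thesis using that[of h] g by simp
qed

text \<open>Here \<open>g\<close> is the exponent left over from the preceding conjugate. Only the
  piece between neighbouring centres is reduced, so every centre stays visible and contributes to
  the length.\<close>

fun conj_product :: "word \<Rightarrow> (nat \<times> word) list \<Rightarrow> word" where
  "conj_product g [] = g"
| "conj_product g ((l, h) # ps) = reduce (g @ fg_inv h) @ (l, True) # conj_product h ps"

lemma conj_product_freely_equal: "conj_product g ps \<simeq> g @ concat (map conj_gen ps)"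
proof (induction g ps rule: conj_product.induct)
  case (2 g l h ps)
  have "reduce (g @ fg_inv h) @ ([(l, True)] @ conj_product h ps) \<simeq>
      (g @ fg_inv h) @ ([(l, True)] @ (h @ concat (map conj_gen ps)))"
    by (intro freely_equal_append 2) simp_all
  then show ?case by (simp add: conj_gen_def[of "(l, h)"])
qed simp

lemma length_conj_product: "length ps \<le> length (conj_product g ps)"
  by (induction g ps rule: conj_product.induct) auto

text \<open>The centres alone account for \<open>length ps\<close> letters, so all pieces between
  them are empty, as is the last exponent. From right to left, each exponent then equals its trivial
  successor.\<close>

lemma conj_product_trivial:
  assumes "length (conj_product g ps) \<le> length ps" "reduced g" "\<forall>p\<in>set ps. reduced (snd p)"
  shows "g = [] \<and> (\<forall>p\<in>set ps. snd p = [])"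
  using assms
proof (induction g ps rule: conj_product.induct)
  case (2 g l h ps)
  have "length (reduce (g @ fg_inv h)) + length (conj_product h ps) \<le> length ps"
    using "2.prems"(1) by simp
  then have "length (reduce (g @ fg_inv h)) = 0" "length (conj_product h ps) \<le> length ps"
    using length_conj_product[of ps h] by linarith+
  moreover from this 2 have "h = [] \<and> (\<forall>p\<in>set ps. snd p = [])" by simp
  ultimately show ?case using "2.prems"(2) by (simp add: reduce_reduced)
qed simp

text \<open>If neither exponent absorbs the centre of the neighbouring conjugate, both centres survive
  in the product.\<close>
lemma reduced_between_centres:
  assumes g: "reduced (conj_gen (k, g))" and h: "reduced (conj_gen (l, h))"
    and no: "\<nexists>y. h = y @ (k, True) # g" "\<nexists>x. g = x @ (l, False) # h"
    and v: "v = reduce (g @ fg_inv h)"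
  shows "reduced ((k, True) # v @ [(l, True)])"
proof -
  obtain x y c where c: "g = x @ c" "h = y @ c" and red: "reduced (x @ fg_inv y)"
    using common_suffix_decomposition[OF reduced_conj_genD(1)[OF g] reduced_conj_genD(1)[OF h]] .
  have "x @ (c @ fg_inv c @ fg_inv y) \<simeq> x @ fg_inv y"
    by (intro freely_equal_append refl cancel_fg_inv_right)
  then have v_eq: "v = x @ fg_inv y" using v c red by (simp add: reduce_reduced)
  \<comment> \<open>If \<open>x\<close> is nonempty, reducedness of \<open>(k, True) # g\<close>
    keeps the centre alive. If \<open>x\<close> is empty, a cancellation would mean that
    \<open>y\<close> ends in \<open>(k, True)\<close>, so that \<open>h\<close> absorbs the centre
    together with \<open>g\<close>.\<close>
  have hd: "v = [] \<or> hd v \<noteq> (k, False)"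
  proof (cases x)
    case Nil
    show ?thesis
    proof (cases y rule: rev_cases)
      case (snoc y' a)
      then have "a \<noteq> (k, True)" using no(1) c Nil by auto
      then show ?thesis using v_eq Nil snoc by (cases a) (auto simp: inv_letter_def)
    qed (simp add: v_eq Nil)
  next
    case (Cons a x')
    then show ?thesis
      using reduced_conj_genD(2)[OF g] c v_eq by (auto simp: reduced_Cons inv_letter_def)
  qed
  have last: "v = [] \<or> last v \<noteq> (l, False)"
  proof (cases y)
    case Nil
    show ?thesis
    proof (cases x rule: rev_cases)
      case (snoc x' a)
      then show ?thesis using no(2) c Nil v_eq by auto
    qed (simp add: v_eq Nil)
  next
    case (Cons a y')
    then show ?thesis
      using reduced_conj_genD(4)[OF h] c v_eq by (cases a) (auto simp: inv_letter_def)
  qed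
  show ?thesis
    using hd last red unfolding v_eq[symmetric]
    by (cases "last v") (auto simp: reduced_Cons reduced_append hd_append inv_letter_def)
qed

lemma reduced_conj_product:
  assumes "reduced (conj_gen (k, g))" "\<forall>p\<in>set ps. reduced (conj_gen p)"
    and "\<And>A k' g' l h B. (k, g) # ps = A @ (k', g') # (l, h) # B \<Longrightarrow>
      (\<nexists>y. h = y @ (k', True) # g') \<and> (\<nexists>x. g' = x @ (l, False) # h)"
  shows "reduced ((k, True) # conj_product g ps)"
  using assms
proof (induction ps arbitrary: k g)
  case Nil
  then show ?case using reduced_conj_genD(2) by simp
next
  case (Cons p ps)
  obtain l h where p: "p = (l, h)" by (cases p)
  have "reduced ((l, True) # conj_product h ps)"
  proof (rule Cons.IH)
    fix A k' g' l' h' B assume "(l, h) # ps = A @ (k', g') # (l', h') # B"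
    then show "(\<nexists>y. h' = y @ (k', True) # g') \<and> (\<nexists>x. g' = x @ (l', False) # h')"
      using Cons.prems(3)[of "(k, g) # A" k' g' l' h' B] p by simp
  qed (use Cons.prems p in auto)
  moreover have "reduced ((k, True) # reduce (g @ fg_inv h) @ [(l, True)])"
    by (rule reduced_between_centres)
      (use Cons.prems(1,2) Cons.prems(3)[of "[]" k g l h ps] p in auto)
  ultimately have "reduced (((k, True) # reduce (g @ fg_inv h)) @ (l, True) # conj_product h ps)"
    unfolding reduced_append[of "(k, True) # reduce (g @ fg_inv h)"]
    by (metis append_Cons list.sel(1) not_Cons_self2 reduced_append)
  then show ?case by (simp add: p)
qed

lemma reduced_positive: "reduced (map (\<lambda>i. (f i, True)) xs)"
  by (induction xs) (auto simp: reduced_Cons hd_map inv_letter_def)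

text \<open>Without any absorption \<open>conj_product [] ps\<close> is already reduced, hence equal
  to the given positive word with one letter per conjugate. There is then no room for letters other
  than the centres.\<close>

lemma artin_reduction:
  assumes red: "\<forall>p\<in>set ps. reduced (conj_gen p)"
    and prod: "concat (map conj_gen ps) \<simeq> map (\<lambda>i. (i, True)) xs" "length xs = length ps"
    and nontriv: "\<exists>p\<in>set ps. snd p \<noteq> []"
  obtains A k g l h B where "ps = A @ (k, g) # (l, h) # B"
    "(\<exists>y. h = y @ (k, True) # g) \<or> (\<exists>x. g = x @ (l, False) # h)"
proof -
  have "\<exists>A k g l h B. ps = A @ (k, g) # (l, h) # B \<and>
    ((\<exists>y. h = y @ (k, True) # g) \<or> (\<exists>x. g = x @ (l, False) # h))"
  proof (rule ccontr)
    assume no: "\<not> ?thesis"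
    obtain k g ps' where ps: "ps = (k, g) # ps'" using nontriv by (cases ps) auto
    have "reduced ((k, True) # conj_product g ps')"
    proof (rule reduced_conj_product)
      fix A k' g' l h B assume "(k, g) # ps' = A @ (k', g') # (l, h) # B"
      then show "(\<nexists>y. h = y @ (k', True) # g') \<and> (\<nexists>x. g' = x @ (l, False) # h)"
        using no unfolding ps by blast
    qed (use red ps in auto)
    moreover have "reduced (fg_inv g @ [(k, True)])"
      using reduced_conj_genD(3) red ps by simp
    ultimately have "reduced (fg_inv g @ (k, True) # conj_product g ps')"
      by (auto simp: reduced_append)
    moreover have "reduce (fg_inv g) = fg_inv g"
      by (rule reduce_reduced[OF reduced_fg_inv[OF reduced_conj_genD(1)[of k g]]]) (use red ps in
          simp)
    ultimately have "reduced (conj_product [] ps)" by (simp add: ps)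
    then have "conj_product [] ps = map (\<lambda>i. (i, True)) xs"
      using conj_product_freely_equal[of "[]" ps] prod(1)
      by (simp add: reduce_reduced reduced_positive)
    then have "length (conj_product [] ps) \<le> length ps" using prod(2) by simp
    then have "\<forall>p\<in>set ps. snd p = []"
      using conj_product_trivial[of "[]" ps] red reduced_conj_genD(1)
          by (metis prod.collapse reduced.simps(1))
    then show False using nontriv by blast
  qed
  then show ?thesis using that by blast
qed

lemma cancel_fg_inv_in_context: "u @ g @ fg_inv g @ v \<simeq> u @ v"
  by (rule freely_equal_append[OF refl cancel_fg_inv_right])

text \<open>The tuple need not be known to come from an automorphism: the product equation suffices
  for Artin's argument, and each step preserves it.\<close>

lemma drawable_braid_image:
  assumes "length ps = n" "concat (map conj_gen ps) \<simeq> map (\<lambda>i. (i, True)) [1..<Suc n]"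
      "drawable n w"
  shows "drawable n (reduce (word_image (\<lambda>i. conj_gen (ps ! (i - 1))) w))"
  using assms
proof (induction "\<Sum>p\<leftarrow>ps. length (snd p)" arbitrary: ps w rule: less_induct)
  case less
  let ?P = "map (\<lambda>i. (i, True)) [1..<Suc n]"
  let ?v = "\<lambda>i. conj_gen (ps ! (i - 1))"
  note letters = drawable_letters[OF less.prems(3)]
  show ?case
  proof (cases "\<forall>p\<in>set ps. reduced (conj_gen p)")
    case False
    then obtain k g where kg: "(k, g) \<in> set ps" "\<not> reduced (conj_gen (k, g))" by auto
    obtain h where h: "length h < length g" "conj_gen (k, h) \<simeq> conj_gen (k, g)"
      using conj_gen_shorten[OF kg(2)] .
    obtain A B where ps: "ps = A @ (k, g) # B" using split_list[OF kg(1)] by blast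
    define qs where "qs = A @ (k, h) # B"
    let ?u = "\<lambda>i. conj_gen (qs ! (i - 1))"
    have "concat (map conj_gen A) @ conj_gen (k, h) @ concat (map conj_gen B) \<simeq>
        concat (map conj_gen A) @ conj_gen (k, g) @ concat (map conj_gen B)"
      by (intro freely_equal_append refl h)
    then have "concat (map conj_gen qs) \<simeq> ?P" using less.prems(2) by (simp add: ps qs_def)
    moreover have "(\<Sum>p\<leftarrow>qs. length (snd p)) < (\<Sum>p\<leftarrow>ps. length (snd p))"
      using h(1) by (simp add: ps qs_def)
    moreover have "length qs = n" using less.prems(1) by (simp add: ps qs_def)
    ultimately have "drawable n (reduce (word_image ?u w))"
      using less.hyps less.prems(3) by blast
    moreover have "word_image ?u w \<simeq> word_image ?v w"
      by (rule word_image_cong) (auto simp: ps qs_def nth_append nth_Cons' h(2))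
    ultimately show ?thesis by simp
  next
    case red: True
    show ?thesis
    proof (cases "\<forall>p\<in>set ps. snd p = []")
      case True
      \<comment> \<open>With trivial exponents the product is the word of the centres. These are
        therefore 1, ..., n in this order, and the substitution is the identity.\<close>
      have "concat (map conj_gen ps) = map (\<lambda>p. (fst p, True)) ps"
        using True by (induction ps) (auto simp: conj_gen_def)
      then have "map (\<lambda>p. (fst p, True)) ps = ?P"
        using less.prems(2) reduced_positive[of fst ps] reduced_positive[of "\<lambda>i. i" "[1..<Suc n]"]
        by (simp add: reduce_reduced del: upt_Suc)
      then have "map fst (map (\<lambda>p. (fst p, True)) ps) = map fst ?P" by (rule arg_cong)
      then have fst: "map fst ps = [1..<Suc n]" by (simp add: comp_def del: upt_Suc)
      have "ps ! (i - 1) = (i, [])" if "i \<in> {1..n}" for i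
      proof -
        have i: "i - 1 < length ps" using that less.prems(1) by auto
        have "fst (ps ! (i - 1)) = map fst ps ! (i - 1)" using i by simp
        also have "\<dots> = i" unfolding fst using that by (simp del: upt_Suc)
        finally show ?thesis using True i by (metis nth_mem prod.collapse)
      qed
      then have "letter_image ?v a = [a]" if "a \<in> set w" for a
        using letters that by (cases a) (auto simp: letter_image_def conj_gen_def inv_letter_def)
      then have "word_image ?v w = w"
        unfolding word_image_def by (induction w) auto
      then show ?thesis using drawable_reduce[OF less.prems(3)] by simp
    next
      case False
      obtain A k g l h B where ps: "ps = A @ (k, g) # (l, h) # B"
        and or: "(\<exists>y. h = y @ (k, True) # g) \<or> (\<exists>x. g = x @ (l, False) # h)"
        by (rule artin_reduction[OF red less.prems(2)]) (use less.prems(1) False in auto)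
      define i where "i = Suc (length A)"
      have i: "1 \<le> i" "Suc i \<le> n" using less.prems(1) by (auto simp: i_def ps)
      have v: "?v i = conj_gen (k, g)" "?v (Suc i) = conj_gen (l, h)"
        by (simp_all add: i_def ps nth_append)
      have others: "?v j = conj_gen ((A @ X # Y # B) ! (j - 1))"
        if "j \<in> fst ` set w" "j \<noteq> i" "j \<noteq> Suc i" for j X Y
      proof -
        \<comment> \<open>Index 0 would read the same list entry as index 1, since
          \<open>0 - 1 = 0\<close>.\<close>
        have "1 \<le> j" using that(1) letters by force
        then show ?thesis using that(2,3) by (auto simp: ps i_def nth_append nth_Cons')
      qed
      from or show ?thesis
      proof (elim disjE exE)
        fix y assume y: "h = y @ (k, True) # g"
        \<comment> \<open>From t_k g = g (g^-1 t_k g) follows h = (y g) (g^-1 t_k g): conjugating by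
          \<open>h\<close> is conjugating by the shorter \<open>y @ g\<close> and then by the left
          neighbour.\<close>
        define qs where "qs = A @ (l, y @ g) # (k, g) # B"
        let ?u = "\<lambda>i. conj_gen (qs ! (i - 1))"
        have u: "?u i = conj_gen (l, y @ g)" "?u (Suc i) = conj_gen (k, g)"
          by (simp_all add: i_def qs_def nth_append)
        have "fg_inv (conj_gen (k, g)) @ conj_gen (l, y @ g) @ conj_gen (k, g) \<simeq>
            (fg_inv g @ [(k, False)]) @ g @ fg_inv g @ (fg_inv y @ (l, True) # y @ g @ fg_inv g @
                (k, True) # g)"
          by (simp add: conj_gen_def inv_letter_def)
        also have "\<dots> = reduce ((fg_inv g @ [(k, False)] @ fg_inv y @ (l, True) # y) @ g @
            fg_inv g @ (k, True) # g)"
          by (subst cancel_fg_inv_in_context) simp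
        also have "\<dots> = reduce (conj_gen (l, h))"
          unfolding cancel_fg_inv_in_context by (simp add: conj_gen_def y inv_letter_def)
        finally have rel: "conj_gen (l, h) \<simeq> fg_inv (conj_gen (k, g)) @ conj_gen (l, y @ g) @
            conj_gen (k, g)"
          by simp
        have "conj_gen (k, g) @ conj_gen (l, h) \<simeq>
            conj_gen (k, g) @ (fg_inv (conj_gen (k, g)) @ conj_gen (l, y @ g) @ conj_gen (k, g))"
          by (rule freely_equal_append[OF refl rel])
        also have "\<dots> = reduce (conj_gen (l, y @ g) @ conj_gen (k, g))"
          by (rule cancel_fg_inv_right)
        finally have swap: "conj_gen (k, g) @ conj_gen (l, h) \<simeq> conj_gen (l, y @ g) @ conj_gen (k,
            g)" .
        have "concat (map conj_gen A) @ (conj_gen (k, g) @ conj_gen (l, h)) @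
            concat (map conj_gen B) \<simeq>
            concat (map conj_gen A) @ (conj_gen (l, y @ g) @ conj_gen (k, g)) @
                concat (map conj_gen B)"
          by (rule freely_equal_append[OF refl freely_equal_append[OF swap refl]])
        then have "concat (map conj_gen qs) \<simeq> ?P" using less.prems(2) by (simp add: ps qs_def)
        moreover have "(\<Sum>p\<leftarrow>qs. length (snd p)) < (\<Sum>p\<leftarrow>ps. length (snd p))"
          by (simp add: ps qs_def y)
        moreover have "length qs = n" using less.prems(1) by (simp add: ps qs_def)
        moreover have "drawable n (concat (map (half_twist i) w))"
          by (rule drawable_half_twist[OF less.prems(3) i])
        ultimately have "drawable n (reduce (word_image ?u (concat (map (half_twist i) w))))"
          using less.hyps by blast
        moreover have "word_image ?u (concat (map (half_twist i) w)) \<simeq> word_image ?v w"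
        proof (rule word_image_half_twist)
          show "?v i = ?u (Suc i)" unfolding u v ..
          show "?v (Suc i) \<simeq> fg_inv (?u (Suc i)) @ ?u i @ ?u (Suc i)" unfolding u v by (rule rel)
        qed (unfold qs_def, rule others)
        ultimately show ?thesis by simp
      next
        fix x assume x: "g = x @ (l, False) # h"
        \<comment> \<open>Symmetrically, g = (x h) (h^-1 t_l h)^-1, so the inverse of the right
          neighbour is split off from \<open>g\<close>.\<close>
        define qs where "qs = A @ (l, h) # (k, x @ h) # B"
        let ?u = "\<lambda>i. conj_gen (qs ! (i - 1))"
        have u: "?u i = conj_gen (l, h)" "?u (Suc i) = conj_gen (k, x @ h)"
          by (simp_all add: i_def qs_def nth_append)
        have "conj_gen (l, h) @ conj_gen (k, x @ h) @ fg_inv (conj_gen (l, h)) \<simeq>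
            (fg_inv h @ [(l, True)]) @ h @ fg_inv h @ (fg_inv x @ (k, True) # x @ h @ fg_inv h @
                (l, False) # h)"
          by (simp add: conj_gen_def inv_letter_def)
        also have "\<dots> = reduce ((fg_inv h @ [(l, True)] @ fg_inv x @ (k, True) # x) @ h @
            fg_inv h @ (l, False) # h)"
          by (subst cancel_fg_inv_in_context) simp
        also have "\<dots> = reduce (conj_gen (k, g))"
          unfolding cancel_fg_inv_in_context by (simp add: conj_gen_def x inv_letter_def)
        finally have rel: "conj_gen (k, g) \<simeq> conj_gen (l, h) @ conj_gen (k, x @ h) @
            fg_inv (conj_gen (l, h))"
          by simp
        have "conj_gen (k, g) @ conj_gen (l, h) \<simeq>
            (conj_gen (l, h) @ conj_gen (k, x @ h) @ fg_inv (conj_gen (l, h))) @ conj_gen (l, h)"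
          by (rule freely_equal_append[OF rel refl])
        also have "\<dots> = reduce (conj_gen (l, h) @ conj_gen (k, x @ h))"
          using freely_equal_append[OF refl cancel_fg_inv_left[of "conj_gen (l, h)" "[]"],
              of "conj_gen (l, h) @ conj_gen (k, x @ h)"] by simp
        finally have swap: "conj_gen (k, g) @ conj_gen (l, h) \<simeq> conj_gen (l, h) @ conj_gen (k, x @
            h)" .
        have "concat (map conj_gen A) @ (conj_gen (k, g) @ conj_gen (l, h)) @
            concat (map conj_gen B) \<simeq>
            concat (map conj_gen A) @ (conj_gen (l, h) @ conj_gen (k, x @ h)) @
                concat (map conj_gen B)"
          by (rule freely_equal_append[OF refl freely_equal_append[OF swap refl]])
        then have "concat (map conj_gen qs) \<simeq> ?P" using less.prems(2) by (simp add: ps qs_def)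
        moreover have "(\<Sum>p\<leftarrow>qs. length (snd p)) < (\<Sum>p\<leftarrow>ps. length (snd p))"
          by (simp add: ps qs_def x)
        moreover have "length qs = n" using less.prems(1) by (simp add: ps qs_def)
        moreover have "drawable n (concat (map (half_twist_inv i) w))"
          by (rule drawable_half_twist_inv[OF less.prems(3) i])
        ultimately have "drawable n (reduce (word_image ?u (concat (map (half_twist_inv i) w))))"
          using less.hyps by blast
        moreover have "word_image ?u (concat (map (half_twist_inv i) w)) \<simeq> word_image ?v w"
        proof (rule word_image_half_twist_inv)
          show "?v (Suc i) = ?u i" unfolding u v ..
          show "?v i \<simeq> ?u i @ ?u (Suc i) @ fg_inv (?u i)" unfolding u v by (rule rel)
        qed (unfold qs_def, rule others)
        ultimately show ?thesis by simp
      qed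
    qed
  qed
qed

section \<open>Automorphisms in B_n as substitutions\<close>

lemma FG_reduced: "w \<in> FG n \<Longrightarrow> reduced w"
  by (simp add: FG_def)

lemma aut_eq_word_image:
  assumes aut: "is_aut n \<phi>" and gens: "\<And>i. i \<in> {1..n} \<Longrightarrow> \<phi> (gen i) = reduce (u i)"
    and "w \<in> FG n"
  shows "\<phi> w = reduce (word_image u w)"
proof -
  have closed: "\<phi> v \<in> FG n" if "v \<in> FG n" for v
    using aut that unfolding is_aut_def by (meson bij_betwE)
  have hom: "\<phi> (reduce (v @ v')) = reduce (\<phi> v @ \<phi> v')" if "v \<in> FG n" "v' \<in> FG n" for v v'
    using aut that unfolding is_aut_def fg_mult_def by blast
  have Nil_in: "[] \<in> FG n" by (simp add: FG_def)
  have one: "\<phi> [] = []"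
  proof -
    \<comment> \<open>The image of the identity is idempotent, hence trivial.\<close>
    have "fg_inv (\<phi> []) @ \<phi> [] @ \<phi> [] \<simeq> fg_inv (\<phi> []) @ \<phi> []"
      using hom[OF Nil_in Nil_in] FG_reduced[OF closed[OF Nil_in]]
      by (intro freely_equal_append refl) (simp add: reduce_reduced)
    then have "\<phi> [] \<simeq> []"
      using cancel_fg_inv_left[of "\<phi> []" "\<phi> []"] cancel_fg_inv_left[of "\<phi> []" "[]"] by simp
    then show ?thesis using FG_reduced[OF closed[OF Nil_in]] by (simp add: reduce_reduced)
  qed
  have letter: "\<phi> [a] \<simeq> letter_image u a" if a: "fst a \<in> {1..n}" for a
  proof -
    obtain i b where a_eq: "a = (i, b)" by (cases a)
    have gen_i: "\<phi> [(i, True)] = reduce (u i)" using gens[of i] a a_eq by (simp add: gen_def)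
    show ?thesis
    proof (cases b)
      case True
      then show ?thesis using gen_i a_eq by (simp add: letter_image_def)
    next
      case False
      have "[(i, True)] \<in> FG n" "[(i, False)] \<in> FG n" using a a_eq by (auto simp: FG_def)
      from hom[OF this] have "\<phi> [(i, True)] @ \<phi> [(i, False)] \<simeq> []" using one
          by (simp add: inv_letter_def)
      then have "fg_inv (\<phi> [(i, True)]) @ (\<phi> [(i, True)] @ \<phi> [(i, False)]) \<simeq> fg_inv (\<phi> [(i,
          True)]) @ []"
        by (intro freely_equal_append refl)
      then have "\<phi> [(i, False)] \<simeq> fg_inv (\<phi> [(i, True)])"
        using cancel_fg_inv_left[of "\<phi> [(i, True)]" "\<phi> [(i, False)]"] by simp
      also have "\<dots> = reduce (fg_inv (u i))"
        unfolding gen_i by (rule freely_equal_fg_inv) simp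
      finally show ?thesis using False a_eq by (simp add: letter_image_def)
    qed
  qed
  show ?thesis
    using assms(3)
  proof (induction w)
    case Nil
    then show ?case using one by simp
  next
    case (Cons a w)
    have in_FG: "[a] \<in> FG n" "w \<in> FG n" and a: "fst a \<in> {1..n}"
      using Cons.prems by (auto simp: FG_def reduced_Cons)
    have "\<phi> (a # w) = reduce (\<phi> [a] @ \<phi> w)"
      using hom[OF in_FG] FG_reduced[OF Cons.prems] by (metis append_Cons append_Nil reduce_reduced)
    also have "\<dots> = reduce (letter_image u a @ word_image u w)"
      by (rule freely_equal_append[OF letter[OF a]]) (simp add: Cons.IH in_FG)
    finally show ?case by simp
  qed
qed

lemma planar_word_Bn_image:
  assumes "planar_word n w" "\<phi> \<in> Bn n"
  shows "planar_word n (\<phi> w)"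
proof -
  let ?P = "map (\<lambda>i. (i, True)) [1..<Suc n]"
  from assms(2) obtain \<sigma> where aut: "is_aut n \<phi>" and z1: "\<phi> (z1 n) = z1 n"
    and conj: "\<forall>i\<in>{1..n}. conjugate n (\<phi> (gen i)) (gen (\<sigma> i))"
    unfolding Bn_def by blast
  from conj obtain g where g: "\<And>i. i \<in> {1..n} \<Longrightarrow>
      \<phi> (gen i) = fg_mult (fg_inv (g i)) (fg_mult (gen (\<sigma> i)) (g i))"
    unfolding conjugate_def by metis
  define ps where "ps = map (\<lambda>i. (\<sigma> i, g i)) [1..<Suc n]"
  let ?u = "\<lambda>i. conj_gen (ps ! (i - 1))"
  have u: "?u i = conj_gen (\<sigma> i, g i)" if "i \<in> {1..n}" for i
    using that nth_map_upt[of "i - 1" "Suc n" 1 "\<lambda>i. (\<sigma> i, g i)"] by (auto simp: ps_def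
        simp del: upt_Suc)
  have gens: "\<phi> (gen i) = reduce (?u i)" if "i \<in> {1..n}" for i
  proof -
    have "\<phi> (gen i) = reduce (fg_inv (g i) @ reduce ([(\<sigma> i, True)] @ g i))"
      using g[OF that] unfolding fg_mult_def gen_def .
    then show ?thesis unfolding u[OF that] reduce_append_reduce_right by (simp add: conj_gen_def)
  qed
  note image = aut_eq_word_image[OF aut gens]
  have red_P: "reduced ?P" using reduced_positive[of "\<lambda>i. i"] .
  have "z1 n \<in> FG n"
    unfolding z1_def FG_def using reduced_fg_inv[OF red_P] by (auto simp: set_fg_inv inv_letter_def)
  \<comment> \<open>As z_1 is the inverse of t_1 ... t_n, inverting this equation says that the
    product of the conjugates is t_1 ... t_n.\<close>
  then have "reduce (word_image ?u (z1 n)) = z1 n" using image z1 by simp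
  then have "fg_inv (word_image ?u ?P) \<simeq> fg_inv ?P"
    unfolding z1_def word_image_fg_inv using reduced_fg_inv[OF red_P] by (simp only: reduce_reduced)
  from freely_equal_fg_inv[OF this] have "word_image ?u ?P \<simeq> ?P"
    by (simp only: fg_inv_fg_inv)
  moreover have "map (letter_image ?u) ?P = map conj_gen ps"
  proof -
    have "map (letter_image ?u) ?P = map (\<lambda>i. conj_gen (\<sigma> i, g i)) [1..<Suc n]"
      unfolding map_map comp_def
      by (intro map_cong refl) (use u in \<open>auto simp: letter_image_def simp del: upt_Suc\<close>)
    then show ?thesis by (simp add: ps_def comp_def del: upt_Suc)
  qed
  ultimately have "concat (map conj_gen ps) \<simeq> ?P" by (simp only: word_image_def)
  moreover have "length ps = n" by (simp add: ps_def)
  moreover have "drawable n w" using assms(1) unfolding planar_word_iff_drawable by blast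
  ultimately have "drawable n (reduce (word_image ?u w))" by (intro drawable_braid_image)
  moreover have "\<phi> w = reduce (word_image ?u w)"
    using image assms(1) unfolding planar_word_def by blast
  ultimately show ?thesis
    unfolding planar_word_iff_drawable by (simp add: reduced_reduce)
qed

lemma planar_word_gen_1:
  assumes "n \<ge> 1"
  shows "planar_word n (gen 1)"
proof -
  \<comment> \<open>The four entries of the Whitehead expansion of t_1 are already in increasing
    order, so they can be placed at 0, 1, 2, 3.\<close>
  have "drawing n 0 [((1, True), 1, 2)] 3"
    using assms by (auto simp: drawing_def labelled_def noncrossing_def between_def code_def
        inv_letter_def)
  then have "drawable n (gen 1)"
    unfolding drawable_def gen_def by (intro exI[of _ 0] exI[of _ "[((1, True), 1,
        2)]"] exI[of _ 3]) simp
  then show ?thesis by (simp add: planar_word_iff_drawable gen_def)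
qed

theorem theoremA:
  fixes n :: nat
  shows "(\<forall>w \<phi>. planar_word n w \<and> \<phi> \<in> Bn n \<longrightarrow> planar_word n (\<phi> w)) \<and>
         (n \<ge> 1 \<longrightarrow> (\<forall>\<phi>\<in>Bn n. planar_word n (\<phi> (gen 1))))"
  using planar_word_Bn_image planar_word_gen_1 by blast

end
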